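(* Let $\mathbb D\in\mathbb R^{p\times p}$ be symmetric positive definite. Suppose that (1) $\alpha(\mathbb D)=1$; (2) $\nabla^2f(\theta)\succeq\mathbb D_G^2-\mathbb D^2$ for all $\theta\in\mathbb R^p$; and (3) $r\sup_{\|\mathbb Du\|\le r}\|\nabla^3f(\hat\theta+u)\|_{\mathbb D}\le1/2$ for some $r\ge3\sqrt{\mathtt p(\mathbb D)}+3$. Then, for this $r$, $$\mathrm{TV}(\pi_f,\gamma_f)\le\sup_{\|\mathbb Du\|\le r}\|\nabla^3f(\hat\theta+u)\|_{\mathbb D}\;\mathtt p(\mathbb D)+2e^{-\left(r-3\sqrt{\mathtt p(\mathbb D)}\right)^2/3}.$$
   Context: Let $p\ge1$ and let $f:\mathbb R^p\to\mathbb R$ be at least three times differentiable with $\int e^{-f}<\infty$ and with a unique global minimizer $\hat\theta$. Let $\pi_f(\theta)\propto e^{-f(\theta)}$ be the associated probability measure on $\mathbb R^p$. Let $\mathbb D_G\succ0$ be the symmetric positive definite matrix with $\mathbb D_G^2=\nabla^2 f(\hat\theta)$ (assumed positive definite). The Laplace approximation to $\pi_f$ is the Gaussian $\gamma_f=\mathcal N(\hat\theta,\mathbb D_G^{-2})$. $\mathrm{TV}(\mu,\nu)=\sup_A|\mu(A)-\nu(A)|$ is total variation distance. $\|\cdot\|$ is the Euclidean norm of vectors and the operator norm of matrices. For symmetric $\mathbb D\succ0$ define $\alpha(\mathbb D)=\|\mathbb D_G^{-1}\mathbb D\|$ and $\mathtt p(\mathbb D)=\mathrm{Tr}(\mathbb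 D_G^{-2}\mathbb D^2)/\|\mathbb D_G^{-1}\mathbb D\|^2$. For a $p\times p\times p$ tensor $T$, $\|T\|_{\mathbb D}=\sup_{\|\mathbb Du\|=\|\mathbb Dv\|=\|\mathbb Dw\|=1}\langle T,u\otimes v\otimes w\rangle$. *)

theory Defs
  imports "HOL-Analysis.Analysis"
begin

section \<open>Matrices\<close>

definition pos_def :: "real^'n^'n \<Rightarrow> bool" where
  "pos_def A \<longleftrightarrow> transpose A = A \<and> (\<forall>v. v \<noteq> 0 \<longrightarrow> 0 < v \<bullet> (A *v v))"

definition pos_semidef :: "real^'n^'n \<Rightarrow> bool" where
  "pos_semidef A \<longleftrightarrow> transpose A = A \<and> (\<forall>v. 0 \<le> v \<bullet> (A *v v))"

definition op_norm :: "real^'n^'m \<Rightarrow> real" where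
  "op_norm A = onorm (\<lambda>x. A *v x)"

section \<open>Derivatives of a function of several variables\<close>

definition gradient :: "(real^'n \<Rightarrow> real) \<Rightarrow> real^'n \<Rightarrow> real^'n" where
  "gradient f x = (\<chi> i. frechet_derivative f (at x) (axis i 1))"

definition hessian :: "(real^'n \<Rightarrow> real) \<Rightarrow> real^'n \<Rightarrow> real^'n^'n" where
  "hessian f x = matrix (frechet_derivative (gradient f) (at x))"

definition third_deriv :: "(real^'n \<Rightarrow> real) \<Rightarrow> real^'n \<Rightarrow> real^'n^'n^'n" where
  "third_deriv f x = (\<chi> i j k. frechet_derivative (hessian f) (at x) (axis i 1) $ j $ k)"

definition three_times_differentiable :: "(real^'n \<Rightarrow> real) \<Rightarrow> bool" where
  "three_times_differentiable f \<longleftrightarrow>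
     f differentiable_on UNIV \<and> gradient f differentiable_on UNIV \<and> hessian f differentiable_on UNIV"

text \<open>The pairing of a tensor \<open>T\<close> with \<open>u \<otimes> v \<otimes> w\<close>.\<close>

definition tensor_pair :: "real^'n^'n^'n \<Rightarrow> real^'n \<Rightarrow> real^'n \<Rightarrow> real^'n \<Rightarrow> real" where
  "tensor_pair T u v w = (\<Sum>i\<in>UNIV. \<Sum>j\<in>UNIV. \<Sum>k\<in>UNIV. T $ i $ j $ k * u $ i * v $ j * w $ k)"

text \<open>For positive definite \<open>D\<close> the set below is nonempty and bounded, so the supremum is a
  genuine one.\<close>

definition tensor_norm :: "real^'n^'n \<Rightarrow> real^'n^'n^'n \<Rightarrow> real" where
  "tensor_norm D T =
     Sup {tensor_pair T u v w | u v w. norm (D *v u) = 1 \<and> norm (D *v v) = 1 \<and> norm (D *v w) = 1}"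

text \<open>The third derivative need not be continuous, so it may be unbounded near \<open>c\<close>; the supremum is
  therefore taken in the extended reals.\<close>

definition third_deriv_sup ::
    "(real^'n \<Rightarrow> real) \<Rightarrow> real^'n \<Rightarrow> real^'n^'n \<Rightarrow> real \<Rightarrow> ereal" where
  "third_deriv_sup f c D r =
     (SUP u\<in>{u. norm (D *v u) \<le> r}. ereal (tensor_norm D (third_deriv f (c + u))))"

section \<open>Measures\<close>

definition gibbs_measure :: "(real^'n \<Rightarrow> real) \<Rightarrow> (real^'n) measure" where
  "gibbs_measure f =
     density lborel (\<lambda>x. ennreal (exp (- f x) / (LINT y|lborel. exp (- f y))))"

text \<open>The nondegenerate normal distribution with mean \<open>m\<close> and covariance matrix \<open>\<Sigma>\<close>.\<close>

definition gaussian_measure :: "real^'n \<Rightarrow> real^'n^'n \<Rightarrow> (real^'n) measure" where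
  "gaussian_measure m \<Sigma> =
     density lborel (\<lambda>x. ennreal
       (exp (- ((x - m) \<bullet> (matrix_inv \<Sigma> *v (x - m))) / 2) / sqrt ((2 * pi) ^ CARD('n) * det \<Sigma>)))"

text \<open>Meant for probability measures \<open>M\<close> and \<open>N\<close> with \<open>sets M = sets N\<close>.\<close>

definition total_variation :: "'a measure \<Rightarrow> 'a measure \<Rightarrow> real" where
  "total_variation M N = (SUP A\<in>sets M. \<bar>measure M A - measure N A\<bar>)"

section \<open>Scale and effective dimension relative to \<open>D\<^sub>G\<close>\<close>

definition alpha :: "real^'n^'n \<Rightarrow> real^'n^'n \<Rightarrow> real" where
  "alpha DG D = op_norm (matrix_inv DG ** D)"

definition eff_dim :: "real^'n^'n \<Rightarrow> real^'n^'n \<Rightarrow> real" where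
  "eff_dim DG D = trace (matrix_inv (DG ** DG) ** (D ** D)) / (op_norm (matrix_inv DG ** D))\<^sup>2"

end

theory Submission
  imports Defs "HOL-Probability.Probability"
begin

text \<open>
  In the coordinates \<open>x = \<theta> + D\<^sub>G\<^sup>-\<^sup>1 z\<close> the Gaussian becomes standard and the Gibbs measure has density
  proportional to \<open>exp (- R z)\<close> with respect to it, where \<open>R\<close> is the remainder of the quadratic Taylor
  expansion. With \<open>M = D D\<^sub>G\<^sup>-\<^sup>1\<close> the Frobenius norm of \<open>M\<close> is the square root \<open>a\<close> of the effective
  dimension. On the ball \<open>\<bar>M z\<bar> \<le> r\<close> the third derivative gives \<open>\<bar>\<nabla>R z\<bar> \<le> \<tau> \<bar>M z\<bar>\<^sup>2 / 2\<close>.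
  Cut \<open>exp (- R)\<close> off smoothly between the radii \<open>r - 1\<close> and \<open>r\<close> to obtain \<open>G\<close> with mean \<open>Z\<^sub>G\<close>. The
  Gaussian \<open>L\<^sup>1\<close> Poincare inequality bounds the total variation distance between the normalized \<open>G\<close>
  and the Gaussian by \<open>sqrt (pi / 2) / 2\<close> times the mean of \<open>\<bar>\<nabla>G\<bar> / Z\<^sub>G\<close>. The main part of this mean is
  \<open>\<tau> / 2\<close> times the second moment of \<open>\<bar>M z\<bar>\<close> under the normalized \<open>G\<close>, which Jensen's inequality and
  the exact exponential moments of Gaussian quadratic forms bound by a multiple of \<open>a\<^sup>2\<close>, small
  enough for the constant \<open>1\<close> in front of \<open>\<tau> a\<^sup>2\<close>.
  Everything outside the radius \<open>r - 1\<close> is a tail: there the lower bound on the Hessian lets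
  \<open>exp (- R)\<close> grow at most like \<open>exp ((\<bar>M z\<bar> - r)\<^sup>2 / 2 + r (\<bar>M z\<bar> - r) / 4)\<close>, which the Gaussian tail
  \<open>exp (- (\<bar>M z\<bar> - a)\<^sup>2 / 2)\<close> beats.
\<close>

section \<open>The standard Gaussian measure\<close>

lemma nn_integral_lborel_translate:
  fixes f :: "'a::euclidean_space \<Rightarrow> ennreal"
  assumes [measurable]: "f \<in> borel_measurable borel"
  shows "(\<integral>\<^sup>+x. f (x + a) \<partial>lborel) = (\<integral>\<^sup>+x. f x \<partial>lborel)"
proof -
  have "(\<integral>\<^sup>+x. f x \<partial>lborel) = (\<integral>\<^sup>+x. f x \<partial>distr lborel borel ((+) a))"
    by (simp add: lborel_distr_plus)
  also have "\<dots> = (\<integral>\<^sup>+x. f (x + a) \<partial>lborel)"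
    by (subst nn_integral_distr) (auto simp: add.commute)
  finally show ?thesis by simp
qed

lemma nn_integral_lborel_reflect:
  fixes f :: "'a::euclidean_space \<Rightarrow> ennreal"
  assumes [measurable]: "f \<in> borel_measurable borel"
  shows "(\<integral>\<^sup>+x. f (a - x) \<partial>lborel) = (\<integral>\<^sup>+x. f x \<partial>lborel)"
proof -
  have "(\<integral>\<^sup>+x. f x \<partial>lborel) = (\<integral>\<^sup>+x. f x \<partial>distr lborel borel (\<lambda>x. a - x))"
    using lborel_affine[of "-1" a] by (simp add: density_1)
  also have "\<dots> = (\<integral>\<^sup>+x. f (a - x) \<partial>lborel)"
    by (subst nn_integral_distr) auto
  finally show ?thesis by simp
qed

text \<open>Translation invariance determines a measure up to a constant; the unit ball, which \<open>f\<close>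
  preserves, fixes the constant.\<close>

lemma nn_integral_lborel_orthogonal:
  fixes f :: "'a::euclidean_space \<Rightarrow> 'a" and g :: "'a \<Rightarrow> ennreal"
  assumes f: "orthogonal_transformation f" and [measurable]: "g \<in> borel_measurable borel"
  shows "(\<integral>\<^sup>+x. g (f x) \<partial>lborel) = (\<integral>\<^sup>+x. g x \<partial>lborel)"
proof -
  let ?B = "ball (0::'a) 1"
  define h :: "'a \<Rightarrow> ennreal" where "h = indicator ?B"
  have [measurable]: "h \<in> borel_measurable borel" unfolding h_def by (intro borel_measurable_indicator) simp
  have lf: "linear f" by (simp add: f orthogonal_transformation_linear)
  have [measurable]: "f \<in> borel_measurable borel"
    using lf by (intro borel_measurable_continuous_onI linear_continuous_on linear_conv_bounded_linear[THEN iffD1])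
  have hf: "h (f x) = h x" for x
    using orthogonal_transformation_norm[OF f] by (simp add: h_def indicator_def)
  obtain k where k: "f (k y) = y" for y
    using orthogonal_transformation_surj[OF f] by (metis surj_f_inv_f)
  have fm: "f (x + - k y) = f x - y" for x y
    using k lf by (metis add_uminus_conv_diff linear_diff)
  have kx: "f (x + k y) = f x + y" for x y
    using k lf by (metis linear_add)
  \<comment> \<open>Both products equal the double integral of \<open>g (f x) * h (y + f x)\<close>.
    Integrating in \<open>y\<close> first gives this one; translating \<open>x\<close> by
    \<open>- k y\<close> and then reflecting in \<open>y\<close> separates the factors the other
    way.\<close>
  have "(\<integral>\<^sup>+x. g (f x) \<partial>lborel) * (\<integral>\<^sup>+y. h y \<partial>lborel)
      = (\<integral>\<^sup>+x. g (f x) * (\<integral>\<^sup>+y. h y \<partial>lborel) \<partial>lborel)"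
    by (simp add: nn_integral_multc)
  also have "\<dots> = (\<integral>\<^sup>+x. g (f x) * (\<integral>\<^sup>+y. h (y + f x) \<partial>lborel) \<partial>lborel)"
    by (simp add: nn_integral_lborel_translate)
  also have "\<dots> = (\<integral>\<^sup>+x. \<integral>\<^sup>+y. g (f x) * h (y + f x) \<partial>lborel \<partial>lborel)"
    by (simp add: nn_integral_cmult)
  also have "\<dots> = (\<integral>\<^sup>+y. \<integral>\<^sup>+x. g (f x) * h (y + f x) \<partial>lborel \<partial>lborel)"
    by (rule lborel_pair.Fubini') simp
  also have "\<dots> = (\<integral>\<^sup>+y. \<integral>\<^sup>+x. g (f x - y) * h (f x) \<partial>lborel \<partial>lborel)"
  proof (rule nn_integral_cong)
    fix y
    have "(\<integral>\<^sup>+x. g (f x - y) * h (f x) \<partial>lborel)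
      = (\<integral>\<^sup>+x. g (f (x + k y) - y) * h (f (x + k y)) \<partial>lborel)"
      by (subst nn_integral_lborel_translate[where a="k y"]) simp_all
    then show "(\<integral>\<^sup>+x. g (f x) * h (y + f x) \<partial>lborel) = (\<integral>\<^sup>+x. g (f x - y) * h (f x) \<partial>lborel)"
      by (simp add: kx add.commute)
  qed
  also have "\<dots> = (\<integral>\<^sup>+x. \<integral>\<^sup>+y. g (f x - y) * h (f x) \<partial>lborel \<partial>lborel)"
    by (rule lborel_pair.Fubini'[symmetric]) simp
  also have "\<dots> = (\<integral>\<^sup>+x. h x * (\<integral>\<^sup>+y. g y \<partial>lborel) \<partial>lborel)"
  proof (rule nn_integral_cong)
    fix x
    show "(\<integral>\<^sup>+y. g (f x - y) * h (f x) \<partial>lborel) = h x * (\<integral>\<^sup>+y. g y \<partial>lborel)"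
      by (subst nn_integral_multc) (simp_all only: nn_integral_lborel_reflect[OF assms(2)] hf mult.commute, measurable)
  qed
  also have "\<dots> = (\<integral>\<^sup>+y. g y \<partial>lborel) * (\<integral>\<^sup>+x. h x \<partial>lborel)"
    by (simp add: nn_integral_multc mult.commute)
  finally have eq: "(\<integral>\<^sup>+x. g (f x) \<partial>lborel) * emeasure lborel ?B = (\<integral>\<^sup>+y. g y \<partial>lborel) * emeasure lborel ?B"
    by (simp add: h_def)
  have "emeasure lborel ?B \<noteq> 0"
  proof
    assume "emeasure lborel ?B = 0"
    then have "?B \<in> null_sets lborel" by (simp add: null_sets_def)
    then have "negligible ?B"
      unfolding negligible_iff_null_sets by (rule null_sets_completionI)
    moreover have "?B \<noteq> {}" by simp
    ultimately show False using open_not_negligible[OF open_ball] by metis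
  qed
  moreover have "emeasure lborel ?B \<noteq> \<infinity>"
    using emeasure_lborel_ball_finite[of "0::'a" 1] by simp
  ultimately show ?thesis
    using eq by (simp add: ennreal_mult_cancel_left mult.commute[of _ "emeasure lborel ?B"])
qed

section \<open>The standard Gaussian as a product measure, and its rotation invariance\<close>

definition gauss_density :: "'a::euclidean_space \<Rightarrow> real" where
  "gauss_density x = exp (- (norm x)\<^sup>2 / 2) / sqrt (2 * pi) ^ DIM('a)"

definition std_gauss :: "'a::euclidean_space measure" where
  "std_gauss = density lborel (\<lambda>x. ennreal (gauss_density x))"

lemma gauss_density_pos: "gauss_density x > 0"
  by (simp add: gauss_density_def)

lemma gauss_density_nonneg [simp]: "gauss_density x \<ge> 0"
  using gauss_density_pos less_imp_le by blast

lemma gauss_density_measurable [measurable]: "gauss_density \<in> borel_measurable borel"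
  unfolding gauss_density_def by measurable

lemma sets_std_gauss [simp, measurable_cong]: "sets std_gauss = sets borel"
  and space_std_gauss [simp]: "space std_gauss = UNIV"
  by (simp_all add: std_gauss_def)

lemma nn_integral_std_gauss:
  "f \<in> borel_measurable borel \<Longrightarrow>
    (\<integral>\<^sup>+x. f x \<partial>std_gauss) = (\<integral>\<^sup>+x. ennreal (gauss_density x) * f x \<partial>lborel)"
  by (simp add: std_gauss_def nn_integral_density)

lemma gauss_density_prod: "gauss_density x = (\<Prod>b\<in>Basis. std_normal_density (x \<bullet> b))"
proof -
  have "(norm x)\<^sup>2 = (\<Sum>b\<in>Basis. (x \<bullet> b)\<^sup>2)"
    by (metis (no_types, lifting) euclidean_inner power2_eq_square power2_norm_eq_inner sum.cong)
  then show ?thesis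
    by (simp add: gauss_density_def std_normal_density_def prod_dividef sum_negf
        sum_divide_distrib [symmetric] exp_sum [symmetric] flip: prod_constant)
qed

lemma nn_integral_std_gauss_prod:
  fixes f :: "'a::euclidean_space \<Rightarrow> real \<Rightarrow> ennreal"
  assumes [measurable]: "\<And>b. b \<in> Basis \<Longrightarrow> f b \<in> borel_measurable borel"
  shows "(\<integral>\<^sup>+x. (\<Prod>b\<in>Basis. f b (x \<bullet> b)) \<partial>std_gauss)
    = (\<Prod>b\<in>Basis. \<integral>\<^sup>+t. f b t * ennreal (std_normal_density t) \<partial>lborel)"
proof -
  have "(\<integral>\<^sup>+x. (\<Prod>b\<in>Basis. f b (x \<bullet> b)) \<partial>std_gauss)
     = (\<integral>\<^sup>+x. (\<Prod>b\<in>Basis. f b (x \<bullet> b) * ennreal (std_normal_density (x \<bullet> b))) \<partial>lborel)"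
    by (subst nn_integral_std_gauss)
       (auto simp: gauss_density_prod prod.distrib mult.commute simp flip: prod_ennreal intro!: nn_integral_cong)
  also have "\<dots> = (\<Prod>b\<in>Basis. \<integral>\<^sup>+t. f b t * ennreal (std_normal_density t) \<partial>lborel)"
    by (rule nn_integral_lborel_prod) auto
  finally show ?thesis .
qed

lemma nn_integral_std_normal: "(\<integral>\<^sup>+t. ennreal (std_normal_density t) \<partial>lborel) = 1"
proof -
  interpret prob_space "density lborel std_normal_density" by (rule prob_space_normal_density) simp
  show ?thesis using emeasure_space_1 by (simp add: emeasure_density)
qed

lemma prob_space_std_gauss: "prob_space std_gauss"
proof
  have "(\<integral>\<^sup>+x. 1 \<partial>(std_gauss :: 'a measure)) = 1"
    using nn_integral_std_gauss_prod[of "\<lambda>(_::'a) _. 1"] by (simp add: nn_integral_std_normal)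
  then show "emeasure (std_gauss :: 'a measure) (space std_gauss) = 1" by simp
qed

lemma nn_integral_std_gauss_orthogonal:
  fixes f :: "'a::euclidean_space \<Rightarrow> 'a"
  assumes f: "orthogonal_transformation f" and [measurable]: "g \<in> borel_measurable borel"
  shows "(\<integral>\<^sup>+x. g (f x) \<partial>std_gauss) = (\<integral>\<^sup>+x. g x \<partial>std_gauss)"
proof -
  have [measurable]: "f \<in> borel_measurable borel"
    using orthogonal_transformation_linear[OF f]
    by (intro borel_measurable_continuous_onI linear_continuous_on linear_conv_bounded_linear[THEN iffD1])
  have "gauss_density (f x) = gauss_density x" for x
    by (simp add: gauss_density_def orthogonal_transformation_norm[OF f])
  then show ?thesis
    using nn_integral_lborel_orthogonal[OF f, of "\<lambda>x. ennreal (gauss_density x) * g x"]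
    by (simp add: nn_integral_std_gauss)
qed

lemma nn_integral_std_gauss_pair:
  assumes [measurable]: "f \<in> borel_measurable (borel :: ('a::euclidean_space \<times> 'b::euclidean_space) measure)"
  shows "(\<integral>\<^sup>+z. f z \<partial>std_gauss) = (\<integral>\<^sup>+x. \<integral>\<^sup>+y. f (x, y) \<partial>std_gauss \<partial>std_gauss)"
proof -
  have m: "f \<in> borel_measurable (borel \<Otimes>\<^sub>M borel)" by (simp add: borel_prod)
  have mm: "(\<lambda>z. ennreal (gauss_density z) * f z) \<in> borel_measurable (borel \<Otimes>\<^sub>M borel)"
    unfolding borel_prod by measurable
  have d: "gauss_density (x, y) = gauss_density x * gauss_density y" for x :: 'a and y :: 'b
    by (simp add: gauss_density_def norm_Pair power_add mult_exp_exp add_divide_distrib diff_divide_distrib)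
  have [measurable]: "f \<in> borel_measurable (borel \<Otimes>\<^sub>M borel)" using m .
  have "(\<integral>\<^sup>+z. f z \<partial>std_gauss) = (\<integral>\<^sup>+z. ennreal (gauss_density z) * f z \<partial>(lborel \<Otimes>\<^sub>M lborel))"
    by (simp add: nn_integral_std_gauss lborel_prod)
  also have "\<dots> = (\<integral>\<^sup>+x. \<integral>\<^sup>+y. ennreal (gauss_density (x,y)) * f (x, y) \<partial>lborel \<partial>lborel)"
    using mm by (subst lborel.nn_integral_fst[symmetric]) auto
  also have "\<dots> = (\<integral>\<^sup>+x. \<integral>\<^sup>+y. f (x, y) \<partial>std_gauss \<partial>std_gauss)"
    by (simp add: nn_integral_std_gauss d ennreal_mult mult.assoc nn_integral_cmult)
  finally show ?thesis .
qed

text \<open>An orthogonal map taking a basis vector to the direction of \<open>v\<close> reduces the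
  integral to one coordinate, whose absolute value has mean \<open>sqrt (2 / pi)\<close>. The other
  coordinates contribute factors \<open>1\<close>.\<close>

lemma std_gauss_abs_inner:
  fixes v :: "real^'n"
  shows "(\<integral>\<^sup>+y. ennreal \<bar>v \<bullet> y\<bar> \<partial>std_gauss) = ennreal (sqrt (2 / pi) * norm v)"
proof (cases "v = 0")
  case False
  obtain k :: 'n where True by simp
  let ?e = "axis k 1 :: real^'n"
  have eB: "?e \<in> Basis" by (simp add: axis_in_Basis_iff)
  obtain f where f: "orthogonal_transformation f" and fe: "f ?e = v /\<^sub>R norm v"
    using orthogonal_transformation_exists_1[of ?e "v /\<^sub>R norm v"] False by auto
  have "v \<bullet> f y = norm v * (y \<bullet> ?e)" for y
  proof -
    have "v \<bullet> f y = norm v * (f ?e \<bullet> f y)" using False fe by simp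
    also have "\<dots> = norm v * (?e \<bullet> y)" using f by (simp add: orthogonal_transformation_def)
    finally show ?thesis by (simp add: inner_commute)
  qed
  then have "(\<integral>\<^sup>+y. ennreal \<bar>v \<bullet> y\<bar> \<partial>std_gauss) = (\<integral>\<^sup>+y. ennreal (norm v) * ennreal \<bar>y \<bullet> ?e\<bar> \<partial>std_gauss)"
    by (subst nn_integral_std_gauss_orthogonal[OF f, symmetric]) (auto simp: abs_mult ennreal_mult)
  also have "\<dots> = ennreal (norm v) * (\<integral>\<^sup>+y. ennreal \<bar>y \<bullet> ?e\<bar> \<partial>std_gauss)"
    by (rule nn_integral_cmult) simp
  also have "(\<integral>\<^sup>+y. ennreal \<bar>y \<bullet> ?e\<bar> \<partial>std_gauss)
      = (\<integral>\<^sup>+y. (\<Prod>b\<in>Basis. (\<lambda>t. if b = ?e then ennreal \<bar>t\<bar> else 1) (y \<bullet> b)) \<partial>std_gauss)"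
    using eB by (simp add: prod.delta)
  also have "\<dots> = (\<Prod>b\<in>Basis. \<integral>\<^sup>+t. (if b = ?e then ennreal \<bar>t\<bar> else 1) * ennreal (std_normal_density t) \<partial>lborel)"
    by (rule nn_integral_std_gauss_prod) auto
  also have "\<dots> = (\<Prod>b\<in>Basis. if b = ?e then (\<integral>\<^sup>+t. ennreal \<bar>t\<bar> * ennreal (std_normal_density t) \<partial>lborel) else 1)"
    by (intro prod.cong) (auto simp: nn_integral_std_normal)
  also have "\<dots> = (\<integral>\<^sup>+t. ennreal \<bar>t\<bar> * ennreal (std_normal_density t) \<partial>lborel)"
    using eB by (simp add: prod.delta)
  also have "\<dots> = (\<integral>\<^sup>+t. ennreal (std_normal_density t * \<bar>t\<bar>) \<partial>lborel)"
    by (simp add: ennreal_mult mult.commute)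
  also have "\<dots> = ennreal (sqrt (2 / pi))"
    using normal_moment_abs_odd[of 1 0 0]
    by (subst nn_integral_eq_integral) (auto simp: has_bochner_integral_iff)
  finally show ?thesis by (simp add: ennreal_mult mult.commute)
qed simp

text \<open>The cross terms cancel in the sum of the two squared norms. By rotation invariance the
  rotated pair is again a pair of independent standard Gaussians.\<close>

lemma orthogonal_transformation_rotation:
  "orthogonal_transformation (\<lambda>z::'a::euclidean_space \<times> 'a.
     (cos t *\<^sub>R fst z + sin t *\<^sub>R snd z, cos t *\<^sub>R snd z - sin t *\<^sub>R fst z))"
proof -
  have *: "(norm (c *\<^sub>R x + s *\<^sub>R y))\<^sup>2 + (norm (c *\<^sub>R y - s *\<^sub>R x))\<^sup>2
      = (c\<^sup>2 + s\<^sup>2) * ((norm x)\<^sup>2 + (norm y)\<^sup>2)" for x y :: 'a and c s :: real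
    unfolding power2_norm_eq_inner
    by (simp add: inner_add_left inner_diff_left inner_add_right inner_diff_right inner_commute
        power2_eq_square algebra_simps)
  show ?thesis
    unfolding orthogonal_transformation
  proof (intro conjI allI linearI)
    fix z :: "'a \<times> 'a"
    show "norm (cos t *\<^sub>R fst z + sin t *\<^sub>R snd z, cos t *\<^sub>R snd z - sin t *\<^sub>R fst z) = norm z"
      by (simp only: norm_prod_def fst_conv snd_conv *) simp
  qed (simp_all add: scaleR_add_right scaleR_diff_right mult.commute[of _ "cos t"] mult.commute[of _ "sin t"])
qed

lemma nn_integral_abs_diff_le:
  fixes F f :: "real \<Rightarrow> real"
  assumes "a \<le> b" and F: "\<And>t. (F has_real_derivative f t) (at t)" and c: "continuous_on UNIV f"
  shows "ennreal \<bar>F b - F a\<bar> \<le> (\<integral>\<^sup>+t. ennreal \<bar>f t\<bar> * indicator {a..b} t \<partial>lborel)"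
proof -
  have ct: "isCont f t" for t using c by (simp add: continuous_on_eq_continuous_at)
  have hb: "has_bochner_integral lborel (\<lambda>t. f t * indicator {a .. b} t) (F b - F a)"
    using assms ct by (intro has_bochner_integral_FTC_Icc_real) auto
  then have "ennreal \<bar>F b - F a\<bar> = ennreal (norm (integral\<^sup>L lborel (\<lambda>t. f t * indicator {a .. b} t)))"
    by (simp add: has_bochner_integral_iff)
  also have "\<dots> \<le> (\<integral>\<^sup>+t. ennreal (norm (f t * indicator {a .. b} t)) \<partial>lborel)"
    using hb by (intro integral_norm_bound_ennreal) (simp add: has_bochner_integral_iff)
  also have "\<dots> = (\<integral>\<^sup>+t. ennreal \<bar>f t\<bar> * indicator {a..b} t \<partial>lborel)"
    by (intro nn_integral_cong) (auto split: split_indicator)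
  finally show ?thesis .
qed

text \<open>If \<open>X\<close>, \<open>Y\<close> are independent standard normal, then so are \<open>X\<^sub>t = X cos t + Y sin t\<close> and its
  derivative in \<open>t\<close>. Integrating the derivative of \<open>G (X\<^sub>t)\<close> along the quarter turn from \<open>X\<close> to \<open>Y\<close>
  therefore gives an \<open>L\<^sup>1\<close> Poincare inequality whose constant does not depend on the dimension.\<close>

lemma std_gauss_poincare_L1:
  fixes G :: "real^'n \<Rightarrow> real" and g :: "real^'n \<Rightarrow> real^'n"
  assumes G: "\<And>x. (G has_derivative (\<lambda>h. g x \<bullet> h)) (at x)" and g: "continuous_on UNIV g"
  shows "(\<integral>\<^sup>+x. \<integral>\<^sup>+y. ennreal \<bar>G x - G y\<bar> \<partial>std_gauss \<partial>std_gauss)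
    \<le> ennreal (sqrt (pi / 2)) * (\<integral>\<^sup>+x. ennreal (norm (g x)) \<partial>std_gauss)"
proof -
  let ?N = "std_gauss :: ((real^'n) \<times> (real^'n)) measure"
  define X where "X t z = cos t *\<^sub>R fst z + sin t *\<^sub>R snd z" for t and z :: "(real^'n) \<times> (real^'n)"
  define Y where "Y t z = cos t *\<^sub>R snd z - sin t *\<^sub>R fst z" for t and z :: "(real^'n) \<times> (real^'n)"
  define d where "d z t = g (X t z) \<bullet> Y t z" for z t
  have contG: "continuous_on UNIV G"
    using G by (meson continuous_at_imp_continuous_on has_derivative_continuous)
  have [measurable]: "G \<in> borel_measurable borel" "g \<in> borel_measurable borel"
    using contG g by (auto intro: borel_measurable_continuous_onI)
  have orth: "orthogonal_transformation (\<lambda>z. (X t z, Y t z))" for t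
    unfolding X_def Y_def by (rule orthogonal_transformation_rotation)
  have cd: "continuous_on UNIV (\<lambda>p. d (fst p) (snd p))"
    unfolding d_def X_def Y_def
    by (intro continuous_intros continuous_on_compose2[OF g]) auto
  have cd1: "continuous_on UNIV (d z)" for z
  proof -
    have "continuous_on UNIV (\<lambda>t. d (fst (z, t)) (snd (z, t)))"
      by (rule continuous_on_compose2[OF cd]) (intro continuous_intros, simp)
    then show ?thesis by simp
  qed
  have [measurable]: "(\<lambda>p. d (fst p) (snd p)) \<in> borel_measurable (borel \<Otimes>\<^sub>M borel)"
    unfolding borel_prod by (rule borel_measurable_continuous_onI[OF cd])
  have dX: "((\<lambda>t. G (X t z)) has_real_derivative d z t) (at t)" for z t
  proof -
    have "((\<lambda>t. X t z) has_vector_derivative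
        (cos t *\<^sub>R 0 + (- sin t) *\<^sub>R fst z) + (sin t *\<^sub>R 0 + cos t *\<^sub>R snd z)) (at t)"
      unfolding X_def
      by (intro has_vector_derivative_add has_vector_derivative_scaleR has_vector_derivative_const
          DERIV_cos DERIV_sin)
    then have "((\<lambda>t. X t z) has_derivative (\<lambda>h. h *\<^sub>R Y t z)) (at t)"
      by (simp add: has_vector_derivative_def Y_def add.commute)
    from has_derivative_compose[OF this G] show ?thesis
      by (simp add: has_field_derivative_def d_def mult_commute_abs)
  qed
  interpret N: prob_space ?N by (rule prob_space_std_gauss)
  interpret P: pair_sigma_finite ?N "lborel :: real measure" ..
  have "(\<integral>\<^sup>+x. \<integral>\<^sup>+y. ennreal \<bar>G x - G y\<bar> \<partial>std_gauss \<partial>std_gauss)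
      = (\<integral>\<^sup>+z. ennreal \<bar>G (fst z) - G (snd z)\<bar> \<partial>?N)"
    by (subst nn_integral_std_gauss_pair) (auto simp flip: borel_prod)
  \<comment> \<open>The arc \<open>X t z\<close> starts at \<open>fst z\<close> for
    \<open>t = 0\<close> and ends at \<open>snd z\<close> for \<open>t = pi / 2\<close>.\<close>
  also have "\<dots> \<le> (\<integral>\<^sup>+z. \<integral>\<^sup>+t. ennreal \<bar>d z t\<bar> * indicator {0..pi/2} t \<partial>lborel \<partial>?N)"
  proof (rule nn_integral_mono)
    fix z
    show "ennreal \<bar>G (fst z) - G (snd z)\<bar> \<le> (\<integral>\<^sup>+t. ennreal \<bar>d z t\<bar> * indicator {0..pi/2} t \<partial>lborel)"
      using nn_integral_abs_diff_le[OF _ dX[of z] cd1[of z], of 0 "pi/2"]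
      by (simp add: X_def abs_minus_commute)
  qed
  also have "\<dots> = (\<integral>\<^sup>+t. \<integral>\<^sup>+z. ennreal \<bar>d z t\<bar> * indicator {0..pi/2} t \<partial>?N \<partial>lborel)"
    by (intro P.Fubini'[symmetric]) (simp add: case_prod_beta)
  also have "\<dots> = (\<integral>\<^sup>+t. (\<integral>\<^sup>+z. ennreal \<bar>g (fst z) \<bullet> snd z\<bar> \<partial>?N) * indicator {0..pi/2} t \<partial>lborel)"
  proof (rule nn_integral_cong)
    fix t :: real
    have [measurable]: "(\<lambda>z. d z t) \<in> borel_measurable borel"
    proof (rule borel_measurable_continuous_onI)
      have "continuous_on UNIV (\<lambda>z. d (fst (z, t)) (snd (z, t)))"
        by (rule continuous_on_compose2[OF cd]) (intro continuous_intros, simp)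
      then show "continuous_on UNIV (\<lambda>z. d z t)" by simp
    qed
    \<comment> \<open>The pair \<open>(X t z, Y t z)\<close> is a rotation of \<open>z\<close>, so
      this mean does not depend on \<open>t\<close>.\<close>
    have "(\<integral>\<^sup>+z. ennreal \<bar>d z t\<bar> \<partial>?N) = (\<integral>\<^sup>+z. ennreal \<bar>g (fst z) \<bullet> snd z\<bar> \<partial>?N)"
      by (subst nn_integral_std_gauss_orthogonal[OF orth[of t], symmetric])
         (auto simp: d_def simp flip: borel_prod)
    then show "(\<integral>\<^sup>+z. ennreal \<bar>d z t\<bar> * indicator {0..pi/2} t \<partial>?N)
        = (\<integral>\<^sup>+z. ennreal \<bar>g (fst z) \<bullet> snd z\<bar> \<partial>?N) * indicator {0..pi/2} t"
      by (simp add: nn_integral_multc)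
  qed
  also have "\<dots> = (\<integral>\<^sup>+z. ennreal \<bar>g (fst z) \<bullet> snd z\<bar> \<partial>?N) * ennreal (pi / 2)"
    by (simp add: nn_integral_cmult)
  \<comment> \<open>With \<open>fst z\<close> fixed, \<open>snd z\<close> is an independent Gaussian
    and \<open>std_gauss_abs_inner\<close> applies. Together with the length \<open>pi / 2\<close>
    of the arc this produces the constant \<open>sqrt (pi / 2)\<close>.\<close>
  also have "(\<integral>\<^sup>+z. ennreal \<bar>g (fst z) \<bullet> snd z\<bar> \<partial>?N)
      = (\<integral>\<^sup>+x. ennreal (sqrt (2 / pi) * norm (g x)) \<partial>std_gauss)"
    by (subst nn_integral_std_gauss_pair) (auto simp: std_gauss_abs_inner simp flip: borel_prod)
  also have "\<dots> = ennreal (sqrt (2 / pi)) * (\<integral>\<^sup>+x. ennreal (norm (g x)) \<partial>std_gauss)"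
    by (simp add: ennreal_mult nn_integral_cmult)
  also have "\<dots> * ennreal (pi / 2) = ennreal (sqrt (2 / pi) * (pi / 2)) * (\<integral>\<^sup>+x. ennreal (norm (g x)) \<partial>std_gauss)"
    by (subst ennreal_mult) (auto simp: ac_simps)
  also have "sqrt (2 / pi) * (pi / 2) = sqrt (pi / 2)"
  proof (rule real_sqrt_unique[symmetric])
    show "(sqrt (2 / pi) * (pi / 2))\<^sup>2 = pi / 2"
      by (simp add: power_mult_distrib power2_eq_square)
  qed simp
  finally show ?thesis .
qed

section \<open>Gaussian quadratic forms\<close>

lemma symmetric_max_eigenvector:
  fixes f :: "'a::euclidean_space \<Rightarrow> 'a"
  assumes f: "linear f" and sym: "\<And>x y. f x \<bullet> y = x \<bullet> f y"
    and S: "subspace S" "f ` S \<subseteq> S" "S \<noteq> {0}"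
  obtains v c where "v \<in> S" "norm v = 1" "f v = c *\<^sub>R v"
proof -
  let ?K = "S \<inter> sphere 0 1"
  have cont: "continuous_on UNIV f" using f by (simp add: linear_continuous_on linear_conv_bounded_linear)
  have "compact ?K" using S(1) by (simp add: closed_subspace closed_Int_compact)
  moreover have "?K \<noteq> {}"
  proof -
    obtain w where "w \<in> S" "w \<noteq> 0" using S subspace_0 by blast
    then have "w /\<^sub>R norm w \<in> ?K" using S(1) by (simp add: subspace_scale)
    then show ?thesis by blast
  qed
  moreover have "continuous_on ?K (\<lambda>x. x \<bullet> f x)"
    by (intro continuous_intros continuous_on_subset[OF cont]) auto
  \<comment> \<open>A maximizer of the quadratic form on the unit sphere of \<open>S\<close> is an
    eigenvector: the rest of the proof shows by a first variation that the residual \<open>w\<close>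
    is zero.\<close>
  ultimately obtain v where v: "v \<in> ?K" and max: "\<And>x. x \<in> ?K \<Longrightarrow> x \<bullet> f x \<le> v \<bullet> f v"
    using continuous_attains_sup[of ?K "\<lambda>x. x \<bullet> f x"] by blast
  define c where "c = v \<bullet> f v"
  have vn: "v \<bullet> v = 1" using v by (simp add: dot_square_norm)
  have q: "x \<bullet> f x \<le> c * (x \<bullet> x)" if "x \<in> S" for x
  proof (cases "x = 0")
    case False
    have "x /\<^sub>R norm x \<in> ?K" using False that S(1) by (simp add: subspace_scale)
    from max[OF this] have "(x \<bullet> f x) / (norm x)\<^sup>2 \<le> c"
      using f by (simp add: c_def linear_scale field_simps power2_eq_square)
    then show ?thesis using False by (simp add: field_simps power2_norm_eq_inner)
  qed simp
  define w where "w = f v - c *\<^sub>R v"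
  have wS: "w \<in> S" using v S unfolding w_def by (auto intro!: subspace_diff subspace_scale)
  have vw: "v \<bullet> w = 0" by (simp add: w_def inner_diff_right vn c_def)
  \<comment> \<open>Moving \<open>v\<close> in the direction \<open>w\<close> inside
    \<open>S\<close> cannot raise the quadratic form above \<open>c\<close> times the squared norm.
    The gain is linear in \<open>t\<close> and the loss quadratic, so a small positive
    \<open>t\<close> would contradict \<open>w \<noteq> 0\<close>.\<close>
  have lin: "2 * t * (w \<bullet> w) \<le> t\<^sup>2 * (c * (w \<bullet> w) - w \<bullet> f w)" for t
  proof -
    have "v + t *\<^sub>R w \<in> S" using v wS S(1) by (auto intro!: subspace_add subspace_scale)
    from q[OF this] have "v \<bullet> f v + 2 * t * (w \<bullet> f v) + t\<^sup>2 * (w \<bullet> f w) \<le> c * (1 + t\<^sup>2 * (w \<bullet> w))"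
      using f sym[of v w] vw
      by (simp add: linear_add linear_scale inner_add_left inner_add_right vn power2_eq_square
          inner_commute algebra_simps)
    moreover have "w \<bullet> f v = w \<bullet> w"
      using vw by (simp add: w_def inner_diff_right inner_diff_left inner_commute)
    ultimately show ?thesis by (simp add: c_def[symmetric] algebra_simps)
  qed
  have "w \<bullet> w = 0"
  proof (rule ccontr)
    assume "w \<bullet> w \<noteq> 0"
    then have pos: "w \<bullet> w > 0" by simp
    \<comment> \<open>\<open>E\<close> is a positive bound for the quadratic coefficient; at
      \<open>?t\<close> the linear side is then twice the quadratic bound.\<close>
    define E where "E = \<bar>c * (w \<bullet> w) - w \<bullet> f w\<bar> + 1"
    have E: "E > 0" "c * (w \<bullet> w) - w \<bullet> f w \<le> E" by (auto simp: E_def)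
    let ?t = "(w \<bullet> w) / E"
    have "2 * ?t * (w \<bullet> w) \<le> ?t\<^sup>2 * E"
      using lin[of ?t] E by (meson mult_left_mono order_trans zero_le_power2)
    also have "\<dots> = ?t * (w \<bullet> w)" using E by (simp add: power2_eq_square)
    finally have "2 * (?t * (w \<bullet> w)) \<le> ?t * (w \<bullet> w)" by (simp only: mult.assoc)
    moreover have "?t * (w \<bullet> w) > 0" using pos E by simp
    ultimately show False by linarith
  qed
  then have "f v = c *\<^sub>R v" by (simp add: w_def)
  then show ?thesis using v that by auto
qed

text \<open>Eigenvectors are split off one at a time: by symmetry the orthogonal complement of an
  eigenvector in \<open>S\<close> is invariant again, and its dimension is one less.\<close>

lemma symmetric_orthonormal_eigenbasis:
  fixes f :: "'a::euclidean_space \<Rightarrow> 'a"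
  assumes f: "linear f" and sym: "\<And>x y. f x \<bullet> y = x \<bullet> f y"
    and "subspace S" "f ` S \<subseteq> S"
  shows "\<exists>B \<subseteq> S. pairwise orthogonal B \<and> card B = dim S \<and> finite B
     \<and> (\<forall>b\<in>B. norm b = 1 \<and> (\<exists>c. f b = c *\<^sub>R b))"
  using assms(3,4)
proof (induction "dim S" arbitrary: S rule: less_induct)
  case less
  show ?case
  proof (cases "S = {0}")
    case True
    then show ?thesis by (intro exI[of _ "{}"]) auto
  next
    case False
    obtain v c where v: "v \<in> S" "norm v = 1" "f v = c *\<^sub>R v"
      using symmetric_max_eigenvector[OF f sym less.prems False] .
    let ?T = "{y \<in> S. \<forall>x \<in> span {v}. orthogonal x y}"
    have Teq: "?T = {y \<in> S. v \<bullet> y = 0}"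
      by (auto simp: span_singleton orthogonal_def intro: exI[of _ 1])
    have sv: "span {v} \<subseteq> S" using v less.prems(1) by (simp add: span_minimal)
    have "v \<noteq> 0" using v by auto
    then have "dim (span {v}) = 1" by simp
    then have dT: "dim ?T + 1 = dim S"
      using dim_subspace_orthogonal_to_vectors[OF subspace_span less.prems(1) sv] by simp
    have sT: "subspace ?T"
      unfolding Teq using less.prems(1)
      by (auto simp: subspace_def inner_add_right)
    have fT: "f ` ?T \<subseteq> ?T"
      unfolding Teq using less.prems(2) by (auto simp: sym[symmetric] v(3))
    obtain B where B: "B \<subseteq> ?T" "pairwise orthogonal B" "card B = dim ?T" "finite B"
       "\<forall>b\<in>B. norm b = 1 \<and> (\<exists>c. f b = c *\<^sub>R b)"
      using less.hyps[OF _ sT fT] dT by auto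
    have vB: "v \<notin> B" using B(1) v unfolding Teq by (auto simp: dot_square_norm)
    show ?thesis
    proof (intro exI[of _ "insert v B"] conjI)
      show "insert v B \<subseteq> S" using B v by auto
      show "pairwise orthogonal (insert v B)"
        using B(1,2) vB unfolding Teq by (auto simp: pairwise_insert orthogonal_def inner_commute)
      show "card (insert v B) = dim S" using B vB dT by simp
    qed (use B v in auto)
  qed
qed

lemma symmetric_matrix_diagonalize:
  fixes A :: "real^'n^'n"
  assumes "transpose A = A"
  obtains P :: "real^'n^'n" and d :: "'n \<Rightarrow> real"
  where "orthogonal_matrix P" "\<And>z. A *v (P *v z) = P *v (\<chi> i. d i * z $ i)"
proof -
  have "(A *v x) \<bullet> y = x \<bullet> (A *v y)" for x y
    using assms by (metis dot_lmul_matrix transpose_matrix_vector)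
  then obtain B where B: "pairwise orthogonal B" "card B = CARD('n)" "finite B"
       "\<forall>b\<in>B. norm b = 1 \<and> (\<exists>c. A *v b = c *\<^sub>R b)"
    using symmetric_orthonormal_eigenbasis[of "(*v) A" UNIV] by auto
  obtain e where e: "bij_betw e (UNIV :: 'n set) B"
    using B(2,3) by (metis finite_same_card_bij finite_class.finite_UNIV)
  define P :: "real^'n^'n" where "P = (\<chi> i j. e j $ i)"
  have col: "column j P = e j" for j by (simp add: P_def column_def vec_eq_iff)
  have "\<forall>j. \<exists>c. A *v e j = c *\<^sub>R e j" using B(4) e by (metis bij_betw_apply UNIV_I)
  then obtain d where d: "\<And>j. A *v e j = d j *\<^sub>R e j" by metis
  show thesis
  proof
    have "e i \<in> B" for i using e by (metis bij_betw_apply UNIV_I)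
    moreover have "e i \<noteq> e j" if "i \<noteq> j" for i j
      using e that by (auto simp: bij_betw_def inj_def)
    ultimately show "orthogonal_matrix P"
      using B(1,4) by (auto simp: orthogonal_matrix_orthonormal_columns col pairwise_def)
    fix z
    have Pz: "P *v z = (\<Sum>j\<in>UNIV. z $ j *\<^sub>R e j)" for z
      by (simp add: matrix_mult_sum col scalar_mult_eq_scaleR)
    have "A *v (P *v z) = (\<Sum>j\<in>UNIV. z $ j *\<^sub>R (A *v e j))"
      by (simp add: Pz linear_sum[OF matrix_vector_mul_linear] linear_scale[OF matrix_vector_mul_linear])
    also have "\<dots> = P *v (\<chi> i. d i * z $ i)"
      by (simp add: Pz d mult.commute)
    finally show "A *v (P *v z) = P *v (\<chi> i. d i * z $ i)" .
  qed
qed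

text \<open>A matrix is a vector of rows here, so its \<open>norm\<close> is the Frobenius norm and
  not the operator norm.\<close>

lemma norm_matrix_sq: "(norm M)\<^sup>2 = (\<Sum>i\<in>UNIV. \<Sum>j\<in>UNIV. (M $ i $ j)\<^sup>2)" for M :: "real^'n^'m"
  by (simp add: norm_vec_def L2_set_def sum_nonneg)

lemma norm_matrix_mult_orthogonal:
  fixes M :: "real^'n^'m"
  assumes "orthogonal_matrix P"
  shows "norm (M ** P) = norm M"
proof -
  have "orthogonal_transformation ((*v) (transpose P))"
    using assms by (simp add: orthogonal_transformation_matrix orthogonal_matrix_transpose)
  moreover have "(M ** P) $ i = transpose P *v (M $ i)" for i
    by (simp add: matrix_matrix_mult_def matrix_vector_mult_def transpose_def vec_eq_iff mult.commute)
  ultimately have "norm ((M ** P) $ i) = norm (M $ i)" for i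
    by (metis orthogonal_transformation_norm)
  then show ?thesis
    by (simp add: norm_vec_def[of "M ** P"] norm_vec_def[of M])
qed

text \<open>The spectral theorem for \<open>transpose M ** M\<close> makes \<open>d i\<close> the
  squared singular values. Contraction bounds each by \<open>1\<close>; their sum is the sum of the
  squared column norms of \<open>M ** P\<close>, and \<open>P\<close> does not change the Frobenius
  norm.\<close>

lemma singular_values:
  fixes M :: "real^'n^'n"
  assumes M: "\<And>x. norm (M *v x) \<le> norm x"
  obtains P :: "real^'n^'n" and d :: "'n \<Rightarrow> real"
  where "orthogonal_matrix P" "\<And>z. (norm (M *v (P *v z)))\<^sup>2 = (\<Sum>i\<in>UNIV. d i * (z $ i)\<^sup>2)"
    "\<And>i. 0 \<le> d i" "\<And>i. d i \<le> 1" "(\<Sum>i\<in>UNIV. d i) = (norm M)\<^sup>2"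
proof -
  have "transpose (transpose M ** M) = transpose M ** M"
    by (simp add: matrix_transpose_mul)
  then obtain P d where P: "orthogonal_matrix P"
    and d: "\<And>z. (transpose M ** M) *v (P *v z) = P *v (\<chi> i. d i * z $ i)"
    using symmetric_matrix_diagonalize by blast
  have ot: "orthogonal_transformation ((*v) P)" using P by (simp add: orthogonal_transformation_matrix)
  have q: "(norm (M *v (P *v z)))\<^sup>2 = (\<Sum>i\<in>UNIV. d i * (z $ i)\<^sup>2)" for z
  proof -
    have "(norm (M *v (P *v z)))\<^sup>2 = (P *v z) \<bullet> ((transpose M ** M) *v (P *v z))"
      by (metis dot_lmul_matrix dot_square_norm inner_commute matrix_vector_mul_assoc transpose_matrix_vector)
    also have "\<dots> = z \<bullet> (\<chi> i. d i * z $ i)"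
      using ot by (simp add: d orthogonal_transformation_def)
    finally show ?thesis by (simp add: inner_vec_def power2_eq_square mult_ac)
  qed
  have dk: "d k = (norm (M *v (P *v axis k 1)))\<^sup>2" for k
    unfolding q by (simp add: axis_def if_distrib[where f="\<lambda>x. x\<^sup>2"] if_distrib[where f="\<lambda>x. _ * x"] cong: if_cong)
  show thesis
  proof
    show "orthogonal_matrix P" by fact
    show "(norm (M *v (P *v z)))\<^sup>2 = (\<Sum>i\<in>UNIV. d i * (z $ i)\<^sup>2)" for z by (rule q)
    show "0 \<le> d i" for i by (simp add: dk)
    show "d i \<le> 1" for i
    proof -
      have "norm (M *v (P *v axis i 1)) \<le> norm (P *v axis i 1)" by (rule M)
      also have "\<dots> = 1" using orthogonal_transformation_norm[OF ot] by simp
      finally show ?thesis by (simp add: dk power_le_one)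
    qed
    have "(\<Sum>k\<in>UNIV. d k) = (\<Sum>k\<in>UNIV. (norm (column k (M ** P)))\<^sup>2)"
      unfolding dk by (simp only: matrix_vector_mul_assoc flip: matrix_vector_mult_basis)
    also have "\<dots> = (norm (M ** P))\<^sup>2"
      unfolding norm_matrix_sq
      by (subst sum.swap) (simp add: norm_vec_def L2_set_def column_def sum_nonneg)
    finally show "(\<Sum>i\<in>UNIV. d i) = (norm M)\<^sup>2" by (simp add: norm_matrix_mult_orthogonal P)
  qed
qed

section \<open>Exponential moments and tails of Gaussian quadratic forms\<close>

lemma nn_integral_exp_square_std_normal:
  assumes c: "c < 1"
  shows "(\<integral>\<^sup>+t. ennreal (exp (c * t\<^sup>2 / 2)) * ennreal (std_normal_density t) \<partial>lborel) = ennreal (1 / sqrt (1 - c))"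
proof -
  \<comment> \<open>The tilted density is \<open>\<sigma>\<close> times the centred normal density
    of standard deviation \<open>\<sigma>\<close>.\<close>
  define \<sigma> where "\<sigma> = 1 / sqrt (1 - c)"
  have s: "\<sigma> > 0" "\<sigma>\<^sup>2 = 1 / (1 - c)" using c by (auto simp: \<sigma>_def power_divide)
  interpret prob_space "density lborel (normal_density 0 \<sigma>)" using s by (intro prob_space_normal_density)
  have one: "(\<integral>\<^sup>+t. ennreal (normal_density 0 \<sigma> t) \<partial>lborel) = 1"
    using emeasure_space_1 by (simp add: emeasure_density)
  have "exp (c * t\<^sup>2 / 2) * std_normal_density t = \<sigma> * normal_density 0 \<sigma> t" for t
  proof -
    have "c * t\<^sup>2 / 2 + - t\<^sup>2 / 2 = - t\<^sup>2 / (2 * \<sigma>\<^sup>2)" using c by (simp add: s field_simps)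
    then have "exp (c * t\<^sup>2 / 2) * exp (- t\<^sup>2 / 2) = exp (- t\<^sup>2 / (2 * \<sigma>\<^sup>2))" by (simp only: mult_exp_exp)
    moreover have "sqrt (2 * pi * \<sigma>\<^sup>2) = sqrt (2 * pi) * \<sigma>" using s(1) by (simp add: real_sqrt_mult)
    ultimately show ?thesis using s(1) by (simp add: normal_density_def field_simps)
  qed
  then have "(\<integral>\<^sup>+t. ennreal (exp (c * t\<^sup>2 / 2)) * ennreal (std_normal_density t) \<partial>lborel)
     = (\<integral>\<^sup>+t. ennreal \<sigma> * ennreal (normal_density 0 \<sigma> t) \<partial>lborel)"
    using s(1) by (simp flip: ennreal_mult)
  then show ?thesis by (simp add: nn_integral_cmult one) (simp add: \<sigma>_def)
qed

lemma Basis_vec_eq_axis: "(Basis :: (real^'n) set) = range (\<lambda>i. axis i 1)"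
  by (auto simp: Basis_vec_def)

lemma matrix_vector_mult_measurable [measurable]:
  "(\<lambda>x. B *v x) \<in> borel_measurable borel" for B :: "real^'n^'m"
  by (intro borel_measurable_continuous_onI) (rule matrix_vector_mult_linear_continuous_on)

text \<open>In the coordinates given by \<open>P\<close> the form is diagonal, so the integral is a
  product of one-dimensional ones.\<close>

lemma nn_integral_std_gauss_exp_square:
  fixes M :: "real^'n^'n"
  assumes P: "orthogonal_matrix P" and d: "\<And>z. (norm (M *v (P *v z)))\<^sup>2 = (\<Sum>i\<in>UNIV. d i * (z $ i)\<^sup>2)"
    and \<mu>: "\<And>i. \<mu> * d i < 1"
  shows "(\<integral>\<^sup>+x. ennreal (exp (\<mu> * (norm (M *v x))\<^sup>2 / 2)) \<partial>std_gauss)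
     = ennreal (\<Prod>i\<in>UNIV. 1 / sqrt (1 - \<mu> * d i))"
proof -
  have ot: "orthogonal_transformation ((*v) P)" using P by (simp add: orthogonal_transformation_matrix)
  have inj: "inj (\<lambda>i::'n. axis i (1::real))" by (simp add: inj_def axis_eq_axis)
  define k :: "real^'n \<Rightarrow> 'n" where "k b = (SOME i. b = axis i 1)" for b
  have k: "k (axis i 1) = i" for i by (auto simp: k_def axis_eq_axis)
  have "(\<integral>\<^sup>+x. ennreal (exp (\<mu> * (norm (M *v x))\<^sup>2 / 2)) \<partial>std_gauss)
     = (\<integral>\<^sup>+x. ennreal (exp (\<mu> * (norm (M *v (P *v x)))\<^sup>2 / 2)) \<partial>std_gauss)"
    by (rule nn_integral_std_gauss_orthogonal[OF ot, symmetric]) measurable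
  also have "\<dots> = (\<integral>\<^sup>+x. (\<Prod>b\<in>Basis. ennreal (exp (\<mu> * d (k b) * (x \<bullet> b)\<^sup>2 / 2))) \<partial>std_gauss)"
  proof (rule nn_integral_cong)
    fix x :: "real^'n"
    have "exp (\<mu> * (norm (M *v (P *v x)))\<^sup>2 / 2) = (\<Prod>i\<in>UNIV. exp (\<mu> * d i * (x $ i)\<^sup>2 / 2))"
      by (simp add: d sum_distrib_left sum_divide_distrib mult.assoc flip: exp_sum)
    then show "ennreal (exp (\<mu> * (norm (M *v (P *v x)))\<^sup>2 / 2))
        = (\<Prod>b\<in>Basis. ennreal (exp (\<mu> * d (k b) * (x \<bullet> b)\<^sup>2 / 2)))"
      by (simp add: Basis_vec_eq_axis prod.reindex[OF inj] k inner_axis prod_ennreal)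
  qed
  also have "\<dots> = (\<Prod>b\<in>(Basis::(real^'n) set). \<integral>\<^sup>+t. ennreal (exp (\<mu> * d (k b) * t\<^sup>2 / 2)) * ennreal (std_normal_density t) \<partial>lborel)"
    by (rule nn_integral_std_gauss_prod) measurable
  also have "\<dots> = ennreal (\<Prod>i\<in>UNIV. 1 / sqrt (1 - \<mu> * d i))"
    using \<mu> by (simp add: nn_integral_exp_square_std_normal Basis_vec_eq_axis prod.reindex[OF inj] k)
       (subst prod_ennreal, auto simp: less_imp_le)
  finally show ?thesis .
qed

text \<open>For \<open>d\<close> between \<open>0\<close> and \<open>1\<close>, concavity of
  \<open>ln\<close> bounds \<open>1 - \<mu> * d\<close> from below by the \<open>d\<close>-th power
  of \<open>1 - \<mu>\<close>. The product then depends on the \<open>d i\<close> only through their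
  sum, so the ambient dimension never enters.\<close>

lemma std_gauss_exp_square_le:
  fixes M :: "real^'n^'n"
  assumes M: "\<And>x. norm (M *v x) \<le> norm x" and \<mu>: "0 \<le> \<mu>" "\<mu> < 1"
  shows "(\<integral>\<^sup>+x. ennreal (exp (\<mu> * (norm (M *v x))\<^sup>2 / 2)) \<partial>std_gauss)
     \<le> ennreal (exp (- (norm M)\<^sup>2 / 2 * ln (1 - \<mu>)))"
proof -
  obtain P d where P: "orthogonal_matrix P" and d: "\<And>z. (norm (M *v (P *v z)))\<^sup>2 = (\<Sum>i\<in>UNIV. d i * (z $ i)\<^sup>2)"
    and d01: "\<And>i. 0 \<le> d i" "\<And>i. d i \<le> 1" and ds: "(\<Sum>i\<in>UNIV. d i) = (norm M)\<^sup>2"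
    by (rule singular_values[OF M], rule that)
  have lt: "\<mu> * d i < 1" for i
    using \<mu> d01[of i] by (smt (verit) mult_left_le)
  have "1 / sqrt (1 - \<mu> * d i) \<le> exp (- d i / 2 * ln (1 - \<mu>))" for i
  proof -
    have "concave_on {0<..} ln" by (rule ln_concave)
    from concave_onD[OF this, of "d i" 1 "1 - \<mu>"] have "d i * ln (1 - \<mu>) \<le> ln (1 - \<mu> * d i)"
      using \<mu> d01[of i] by (simp add: algebra_simps)
    then have "exp (d i * ln (1 - \<mu>)) \<le> 1 - \<mu> * d i"
      using lt[of i] by (simp add: ln_ge_iff)
    then have "exp (d i / 2 * ln (1 - \<mu>)) \<le> sqrt (1 - \<mu> * d i)"
      by (intro real_le_rsqrt) (simp add: power2_eq_square mult_exp_exp)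
    then have "1 / sqrt (1 - \<mu> * d i) \<le> 1 / exp (d i / 2 * ln (1 - \<mu>))"
      using lt[of i] by (intro divide_left_mono) auto
    then show ?thesis by (simp add: exp_minus field_simps)
  qed
  then have "(\<Prod>i\<in>UNIV. 1 / sqrt (1 - \<mu> * d i)) \<le> (\<Prod>i\<in>UNIV. exp (- d i / 2 * ln (1 - \<mu>)))"
    using lt by (intro prod_mono) (auto simp: less_imp_le)
  also have "\<dots> = exp (\<Sum>i\<in>UNIV. - d i / 2 * ln (1 - \<mu>))"
    by (simp only: exp_sum finite)
  also have "(\<Sum>i\<in>UNIV. - d i / 2 * ln (1 - \<mu>)) = - (norm M)\<^sup>2 / 2 * ln (1 - \<mu>)"
    by (simp only: ds[symmetric] sum_distrib_right[symmetric] sum_divide_distrib[symmetric] sum_negf)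
  finally show ?thesis
    unfolding nn_integral_std_gauss_exp_square[OF P d lt] by (intro ennreal_leI)
qed

text \<open>By \<open>1 + x \<le> exp x\<close> each factor is at least
  \<open>exp (- (\<mu> * d i / 2))\<close>, and again only the sum of the \<open>d i\<close>
  matters.\<close>

lemma std_gauss_exp_square_ge:
  fixes M :: "real^'n^'n"
  assumes M: "\<And>x. norm (M *v x) \<le> norm x" and \<mu>: "0 \<le> \<mu>"
  shows "ennreal (exp (- (\<mu> * (norm M)\<^sup>2 / 2)))
      \<le> (\<integral>\<^sup>+x. ennreal (exp (- \<mu> * (norm (M *v x))\<^sup>2 / 2)) \<partial>std_gauss)"
proof -
  obtain P d where P: "orthogonal_matrix P" and d: "\<And>z. (norm (M *v (P *v z)))\<^sup>2 = (\<Sum>i\<in>UNIV. d i * (z $ i)\<^sup>2)"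
    and d01: "\<And>i. 0 \<le> d i" "\<And>i. d i \<le> 1" and ds: "(\<Sum>i\<in>UNIV. d i) = (norm M)\<^sup>2"
    by (rule singular_values[OF M], rule that)
  have nn: "0 \<le> \<mu> * d i" for i using \<mu> d01 by simp
  have lt: "- \<mu> * d i < 1" for i using nn[of i] by simp
  have "exp (- (\<mu> * d i / 2)) \<le> 1 / sqrt (1 - - \<mu> * d i)" for i
  proof -
    have "sqrt (1 + \<mu> * d i) \<le> exp (\<mu> * d i / 2)"
      using exp_ge_add_one_self[of "\<mu> * d i"]
      by (intro real_le_lsqrt) (auto simp: power2_eq_square mult_exp_exp)
    then have "1 / exp (\<mu> * d i / 2) \<le> 1 / sqrt (1 + \<mu> * d i)"
      using nn[of i] by (intro divide_left_mono) auto
    then show ?thesis by (simp add: exp_minus field_simps)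
  qed
  then have "(\<Prod>i\<in>UNIV. exp (- (\<mu> * d i / 2))) \<le> (\<Prod>i\<in>UNIV. 1 / sqrt (1 - - \<mu> * d i))"
    by (intro prod_mono) auto
  moreover have "(\<Prod>i\<in>UNIV. exp (- (\<mu> * d i / 2))) = exp (- (\<mu> * (norm M)\<^sup>2 / 2))"
    by (simp add: sum_negf ds sum_divide_distrib[symmetric] sum_distrib_left[symmetric] flip: exp_sum)
  ultimately show ?thesis
    unfolding nn_integral_std_gauss_exp_square[OF P d lt] by (intro ennreal_leI) simp
qed

text \<open>Chernoff's bound, applied to the squared norm of \<open>M *v x\<close>.\<close>

lemma std_gauss_tail:
  fixes M :: "real^'n^'n"
  assumes M: "\<And>x. norm (M *v x) \<le> norm x" and t: "norm M \<le> t" and M0: "M \<noteq> 0"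
  shows "emeasure std_gauss {x. t < norm (M *v x)} \<le> ennreal (exp (- (t - norm M)\<^sup>2 / 2))"
proof -
  define a where "a = norm M"
  have a: "a > 0" "a \<le> t" using M0 t by (auto simp: a_def)
  \<comment> \<open>This \<open>\<mu>\<close> minimizes the Chernoff exponent
    \<open>- \<mu> * t\<^sup>2 / 2 - a\<^sup>2 / 2 * ln (1 - \<mu>)\<close>.\<close>
  define \<mu> where "\<mu> = 1 - a\<^sup>2 / t\<^sup>2"
  have \<mu>: "0 \<le> \<mu>" "\<mu> < 1" using a by (auto simp: \<mu>_def)
  have "emeasure std_gauss {x. t < norm (M *v x)} = (\<integral>\<^sup>+x. indicator {x. t < norm (M *v x)} x \<partial>std_gauss)"
    by (subst nn_integral_indicator) auto
  also have "\<dots> \<le> (\<integral>\<^sup>+x. ennreal (exp (- \<mu> * t\<^sup>2 / 2)) * ennreal (exp (\<mu> * (norm (M *v x))\<^sup>2 / 2)) \<partial>std_gauss)"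
  proof (rule nn_integral_mono)
    fix x
    show "indicator {x. t < norm (M *v x)} x \<le> ennreal (exp (- \<mu> * t\<^sup>2 / 2)) * ennreal (exp (\<mu> * (norm (M *v x))\<^sup>2 / 2))"
    proof (cases "t < norm (M *v x)")
      case True
      then have "t\<^sup>2 \<le> (norm (M *v x))\<^sup>2" using a by (intro power_mono) auto
      then have "0 \<le> \<mu> * ((norm (M *v x))\<^sup>2 - t\<^sup>2)" using \<mu> by simp
      then have "1 \<le> exp (- \<mu> * t\<^sup>2 / 2) * exp (\<mu> * (norm (M *v x))\<^sup>2 / 2)"
        unfolding mult_exp_exp by (simp add: algebra_simps)
      then show ?thesis using True by (simp flip: ennreal_mult)
    qed simp
  qed
  also have "\<dots> = ennreal (exp (- \<mu> * t\<^sup>2 / 2)) * (\<integral>\<^sup>+x. ennreal (exp (\<mu> * (norm (M *v x))\<^sup>2 / 2)) \<partial>std_gauss)"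
    by (rule nn_integral_cmult) measurable
  also have "\<dots> \<le> ennreal (exp (- \<mu> * t\<^sup>2 / 2)) * ennreal (exp (- (norm M)\<^sup>2 / 2 * ln (1 - \<mu>)))"
    by (intro mult_left_mono std_gauss_exp_square_le M \<mu>) simp
  also have "\<dots> = ennreal (exp (- \<mu> * t\<^sup>2 / 2 - a\<^sup>2 / 2 * ln (1 - \<mu>)))"
    by (simp add: a_def mult_exp_exp flip: ennreal_mult)
  also have "\<dots> \<le> ennreal (exp (- (t - norm M)\<^sup>2 / 2))"
  proof (intro ennreal_leI exp_mono)
    have "- \<mu> * t\<^sup>2 = a\<^sup>2 - t\<^sup>2" using a by (simp add: \<mu>_def field_simps)
    moreover have "ln (1 - \<mu>) = - (2 * ln (t / a))"
      using a by (simp add: \<mu>_def ln_div ln_realpow)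
    \<comment> \<open>Replacing the logarithm by \<open>t / a - 1\<close> turns the exponent into a
      complete square.\<close>
    moreover have "a\<^sup>2 * ln (t / a) \<le> a\<^sup>2 * (t / a - 1)"
      using a ln_le_minus_one[of "t / a"] by (intro mult_left_mono) auto
    moreover have "a\<^sup>2 * (t / a - 1) = a * t - a\<^sup>2" using a by (simp add: field_simps power2_eq_square)
    ultimately have "- \<mu> * t\<^sup>2 - a\<^sup>2 * ln (1 - \<mu>) \<le> a\<^sup>2 - t\<^sup>2 + 2 * (a * t - a\<^sup>2)"
      by simp
    also have "\<dots> = - (t - a)\<^sup>2" by (simp add: power2_eq_square algebra_simps)
    finally show "- \<mu> * t\<^sup>2 / 2 - a\<^sup>2 / 2 * ln (1 - \<mu>) \<le> - (t - norm M)\<^sup>2 / 2"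
      by (simp add: a_def)
  qed
  finally show ?thesis .
qed

section \<open>Perturbations of the standard Gaussian\<close>

text \<open>Squaring makes the positive part continuously differentiable; two nested copies form the
  cutoff below.\<close>

definition pos_sq :: "real \<Rightarrow> real" where "pos_sq t = (max 0 t)\<^sup>2"

lemma pos_sq_has_derivative: "(pos_sq has_real_derivative 2 * max 0 t) (at t)"
proof -
  consider "t > 0" | "t < 0" | "t = 0" by linarith
  then show ?thesis
  proof cases
    case 1
    have "((\<lambda>t. t\<^sup>2) has_real_derivative 2 * max 0 t) (at t)"
      using 1 by (auto intro!: derivative_eq_intros)
    then show ?thesis
      by (rule has_field_derivative_transform_within_open[where S="{0<..}"]) (use 1 in \<open>auto simp: pos_sq_def\<close>)
  next
    case 2
    have "((\<lambda>t. 0) has_real_derivative 2 * max 0 t) (at t)"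
      using 2 by simp
    then show ?thesis
      by (rule has_field_derivative_transform_within_open[where S="{..<0}"]) (use 2 in \<open>auto simp: pos_sq_def\<close>)
  next
    case 3
    have "((\<lambda>h::real. max 0 h) \<longlongrightarrow> max 0 0) (at 0)" by (intro tendsto_intros)
    then have "((\<lambda>h. (pos_sq (0 + h) - pos_sq 0) / h) \<longlongrightarrow> max 0 0) (at 0)"
      by (rule Lim_transform_within[where d=1]) (auto simp: pos_sq_def max_def power2_eq_square)
    then show ?thesis using 3 by (simp add: DERIV_def)
  qed
qed

lemma pos_sq_bounds: "0 \<le> pos_sq t" "t \<le> 0 \<Longrightarrow> pos_sq t = 0" "t \<le> 1 \<Longrightarrow> pos_sq t \<le> 1" "1 \<le> t \<Longrightarrow> 1 \<le> pos_sq t"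
  by (auto simp: pos_sq_def max_def power_le_one)

text \<open>As \<open>h\<close> has mean zero, half of it can be subtracted from the integrand for
  free, and the indicator minus \<open>1 / 2\<close> has absolute value \<open>1 / 2\<close>. This
  is the factor between total variation and \<open>L1\<close> distance.\<close>

lemma abs_integral_indicator_le:
  fixes h :: "'a \<Rightarrow> real"
  assumes h: "integrable M h" and h0: "(\<integral>x. h x \<partial>M) = 0" and A: "A \<in> sets M"
  shows "\<bar>\<integral>x. indicator A x * h x \<partial>M\<bar> \<le> (\<integral>x. \<bar>h x\<bar> \<partial>M) / 2"
proof -
  have iA: "integrable M (\<lambda>x. indicator A x * h x)"
    using integrable_mult_indicator[OF A h] by simp
  have "(\<integral>x. indicator A x * h x \<partial>M) = (\<integral>x. indicator A x * h x - h x / 2 \<partial>M)"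
    using iA h h0 by simp
  also have "\<bar>\<dots>\<bar> \<le> (\<integral>x. \<bar>indicator A x * h x - h x / 2\<bar> \<partial>M)"
    by (rule integral_abs_bound)
  also have "\<dots> = (\<integral>x. \<bar>h x\<bar> / 2 \<partial>M)"
    by (intro Bochner_Integration.integral_cong) (auto split: split_indicator)
  finally show ?thesis by simp
qed

text \<open>A perturbation \<open>exp (- R)\<close> of the standard Gaussian, where \<open>\<bar>M x\<bar>\<close> measures the distance from the
  mode. The bound on \<open>R\<close> outside the ball of radius \<open>r\<close> is what remains of the cubic bound once
  only a lower bound on the Hessian is available.\<close>

locale gauss_perturbation =
  fixes M :: "real^'n^'n" and R :: "real^'n \<Rightarrow> real" and g :: "real^'n \<Rightarrow> real^'n" and \<tau> r :: real
  assumes M: "\<And>x. norm (M *v x) \<le> norm x"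
    and norm_M: "1 \<le> norm M"
    and R_deriv: "\<And>x. (R has_derivative (\<lambda>h. g x \<bullet> h)) (at x)"
    and g_cont: "continuous_on UNIV g"
    and \<tau>_nonneg: "0 \<le> \<tau>" and r_ge: "3 * norm M + 3 \<le> r" and \<tau>_r: "\<tau> * r \<le> 1 / 2"
    and g_bound: "\<And>x. norm (M *v x) \<le> r \<Longrightarrow> norm (g x) \<le> \<tau> / 2 * (norm (M *v x))\<^sup>2"
    and R_bound: "\<And>x. norm (M *v x) \<le> r \<Longrightarrow> \<bar>R x\<bar> \<le> \<tau> / 6 * (norm (M *v x))^3"
    and R_outer: "\<And>x. r \<le> norm (M *v x) \<Longrightarrow>
      - (r\<^sup>2 / 12 + r * (norm (M *v x) - r) / 4 + (norm (M *v x) - r)\<^sup>2 / 2) \<le> R x"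
    and integrable_R: "integrable std_gauss (\<lambda>x. exp (- R x))"
begin

abbreviation "a \<equiv> norm M"
abbreviation "s x \<equiv> norm (M *v x)"
abbreviation "N \<equiv> (std_gauss :: (real^'n) measure)"

text \<open>The cutoff \<open>\<psi>\<close> is continuously differentiable, \<open>1\<close> for \<open>s x \<le> r - 1\<close> and \<open>0\<close> for \<open>r \<le> s x\<close>.\<close>

definition "W x = exp (- R x)"
text \<open>Squared radii keep \<open>y\<close> differentiable where \<open>M *v x = 0\<close>. The
  squares of \<open>r\<close> and \<open>r - 1\<close> differ by \<open>2 * r - 1\<close>, so
  \<open>y\<close> is \<open>0\<close> at radius \<open>r - 1\<close> and \<open>1\<close> at radius
  \<open>r\<close>.\<close>

definition "y x = ((s x)\<^sup>2 - (r - 1)\<^sup>2) / (2 * r - 1)"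
definition "\<psi> x = pos_sq (1 - pos_sq (y x))"
definition "G x = \<psi> x * W x"
text \<open>The gradient of \<open>\<psi>\<close>, by the chain rule through both copies of
  \<open>pos_sq\<close> and \<open>y\<close>.\<close>

definition "g\<psi> x = (- (2 * max 0 (1 - pos_sq (y x)) * (2 * max 0 (y x))) * (2 / (2 * r - 1)))
   *\<^sub>R (transpose M *v (M *v x))"
definition "gG x = W x *\<^sub>R g\<psi> x - (\<psi> x * W x) *\<^sub>R g x"

sublocale N: prob_space N by (rule prob_space_std_gauss)

lemma r6: "6 \<le> r" using r_ge norm_M by auto

lemma M_nonzero: "M \<noteq> 0" using norm_M by auto

lemma s_cont: "continuous_on UNIV (\<lambda>x. M *v x)"
  by (rule matrix_vector_mult_linear_continuous_on)

lemma R_cont: "continuous_on UNIV R"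
  using R_deriv by (meson continuous_at_imp_continuous_on has_derivative_continuous)

lemma R_meas [measurable]: "R \<in> borel_measurable borel"
  by (rule borel_measurable_continuous_onI[OF R_cont])

lemma W_meas [measurable]: "W \<in> borel_measurable borel"
  unfolding W_def[abs_def] by measurable

lemma W_pos: "0 < W x" by (simp add: W_def)

lemma W_integrable: "integrable N W" using integrable_R by (simp add: W_def[abs_def])

lemma pos_sq_cont: "continuous_on UNIV pos_sq"
  using pos_sq_has_derivative DERIV_isCont by (blast intro: continuous_at_imp_continuous_on)

lemma y_cont: "continuous_on UNIV y"
  unfolding y_def[abs_def] using r6 by (intro continuous_intros s_cont) auto

lemma \<psi>_cont: "continuous_on UNIV \<psi>"
  unfolding \<psi>_def[abs_def]
  by (intro continuous_on_compose2[OF pos_sq_cont] continuous_intros y_cont) auto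

lemma \<psi>_meas [measurable]: "\<psi> \<in> borel_measurable borel"
  by (rule borel_measurable_continuous_onI[OF \<psi>_cont])

lemma y_le0: "s x \<le> r - 1 \<Longrightarrow> y x \<le> 0"
  using r6 by (simp add: y_def divide_nonpos_pos power_mono)

lemma y_ge1: "r \<le> s x \<Longrightarrow> 1 \<le> y x"
proof -
  assume "r \<le> s x"
  then have "r\<^sup>2 \<le> (s x)\<^sup>2" using r6 by (intro power_mono) auto
  then have "2 * r - 1 \<le> (s x)\<^sup>2 - (r - 1)\<^sup>2" by (simp add: power2_eq_square algebra_simps)
  then show ?thesis using r6 by (simp add: y_def)
qed

lemma y_le1: "s x \<le> r \<Longrightarrow> y x \<le> 1"
proof -
  assume "s x \<le> r"
  then have "(s x)\<^sup>2 \<le> r\<^sup>2" by (intro power_mono) auto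
  then have "(s x)\<^sup>2 - (r - 1)\<^sup>2 \<le> 2 * r - 1" by (simp add: power2_eq_square algebra_simps)
  then show ?thesis using r6 by (simp add: y_def)
qed

lemma \<psi>_nonneg: "0 \<le> \<psi> x" and \<psi>_le1: "\<psi> x \<le> 1"
  using pos_sq_bounds(1)[of "y x"] by (auto simp: \<psi>_def pos_sq_bounds)

lemma \<psi>_eq1: "s x \<le> r - 1 \<Longrightarrow> \<psi> x = 1"
  using y_le0[of x] by (simp add: \<psi>_def pos_sq_bounds(2)) (simp add: pos_sq_def)

lemma \<psi>_eq0: "r \<le> s x \<Longrightarrow> \<psi> x = 0"
  using pos_sq_bounds(4)[OF y_ge1[of x]] by (simp add: \<psi>_def pos_sq_bounds(2))

lemma transpose_contraction: "norm (transpose M *v v) \<le> norm v"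
proof -
  let ?w = "transpose M *v v"
  have "(norm ?w)\<^sup>2 = v \<bullet> (M *v ?w)"
    by (metis dot_lmul_matrix dot_square_norm transpose_matrix_vector)
  also have "\<dots> \<le> norm v * norm ?w"
    by (meson M mult_left_mono norm_cauchy_schwarz norm_ge_zero order_trans)
  finally show ?thesis
    by (cases "?w = 0") (auto simp: power2_eq_square)
qed

lemma y_deriv: "(y has_derivative (\<lambda>h. ((2 / (2 * r - 1)) *\<^sub>R (transpose M *v (M *v x))) \<bullet> h)) (at x)"
proof -
  have 1: "((*v) M has_derivative (*v) M) (at x)"
    by (simp add: bounded_linear_imp_has_derivative linear_conv_bounded_linear[symmetric])
  have "((\<lambda>x. ((M *v x) \<bullet> (M *v x) - (r - 1)\<^sup>2) / (2 * r - 1)) has_derivative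
     (\<lambda>h. ((M *v x) \<bullet> (M *v h) + (M *v h) \<bullet> (M *v x)) / (2 * r - 1))) (at x)"
    using r6 by (auto intro!: derivative_eq_intros 1)
  moreover have "(M *v x) \<bullet> (M *v h) = (transpose M *v (M *v x)) \<bullet> h" for h
    by (metis dot_lmul_matrix transpose_matrix_vector)
  ultimately show ?thesis
    unfolding y_def[abs_def] by (simp add: power2_norm_eq_inner inner_commute[of "M *v _" "M *v x"] mult.commute)
qed

lemma \<psi>_deriv: "(\<psi> has_derivative (\<lambda>h. g\<psi> x \<bullet> h)) (at x)"
proof -
  have p: "(pos_sq has_derivative (\<lambda>h. 2 * max 0 t * h)) (at t)" for t
    using pos_sq_has_derivative by (simp add: has_field_derivative_def)
  have 1: "((\<lambda>x. 1 - pos_sq (y x)) has_derivative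
      (\<lambda>h. - (2 * max 0 (y x) * (((2 / (2 * r - 1)) *\<^sub>R (transpose M *v (M *v x))) \<bullet> h)))) (at x)"
    using has_derivative_diff[OF has_derivative_const has_derivative_compose[OF y_deriv p]] by simp
  from has_derivative_compose[OF this p] show ?thesis
    unfolding \<psi>_def[abs_def] g\<psi>_def by (simp add: mult_ac)
qed

lemma gG_cont: "continuous_on UNIV gG"
proof -
  have "continuous_on UNIV (\<lambda>x. transpose M *v (M *v x))"
    by (intro continuous_on_compose2[OF matrix_vector_mult_linear_continuous_on s_cont]) auto
  then show ?thesis
    unfolding gG_def[abs_def] g\<psi>_def W_def using r6
    by (intro continuous_intros \<psi>_cont g_cont y_cont R_cont continuous_on_compose2[OF pos_sq_cont]) auto
qed

lemma G_deriv: "(G has_derivative (\<lambda>h. gG x \<bullet> h)) (at x)"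
proof -
  have "((\<lambda>x. exp (- R x)) has_derivative (\<lambda>h. - (g x \<bullet> h) * exp (- R x))) (at x)"
    by (intro has_derivative_exp has_derivative_minus R_deriv)
  from has_derivative_mult[OF \<psi>_deriv this] show ?thesis
    unfolding G_def[abs_def] W_def gG_def by (simp add: inner_diff_left algebra_simps)
qed

text \<open>The gradient vanishes where \<open>\<psi>\<close> is constant. In the shell between, the
  chain rule constants and \<open>s x \<le> r\<close> give \<open>8 * r / (2 * r - 1)\<close>, which
  is below \<open>5\<close> as \<open>6 \<le> r\<close>.\<close>

lemma g\<psi>_bound: "norm (g\<psi> x) \<le> 5 * indicator {x. r - 1 < s x} x"
proof (cases "r - 1 < s x \<and> s x < r")
  case True
  define A where "A = max 0 (1 - pos_sq (y x))"
  define B where "B = max 0 (y x)"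
  have AB: "0 \<le> A" "A \<le> 1" "0 \<le> B" "B \<le> 1"
    using y_le1[of x] True pos_sq_bounds(1)[of "y x"] by (auto simp: A_def B_def)
  then have AB1: "A * B \<le> 1" "0 \<le> A * B" by (auto intro: mult_le_one)
  have "norm (g\<psi> x) = 8 * (A * B) / (2 * r - 1) * norm (transpose M *v (M *v x))"
    using AB r6 by (simp add: g\<psi>_def A_def[symmetric] B_def[symmetric] abs_mult)
  also have "\<dots> \<le> 8 * 1 / (2 * r - 1) * r"
  proof (intro mult_mono divide_right_mono)
    show "norm (transpose M *v (M *v x)) \<le> r" using transpose_contraction[of "M *v x"] True by linarith
  qed (use AB1 r6 in auto)
  also have "\<dots> \<le> 5" using r6 by (simp add: field_simps)
  finally show ?thesis using True by simp
next
  case False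
  then consider "s x \<le> r - 1" | "r \<le> s x" by linarith
  then have "g\<psi> x = 0"
  proof cases
    case 1
    then show ?thesis using y_le0[of x] by (simp add: g\<psi>_def)
  next
    case 2
    then show ?thesis using pos_sq_bounds(4)[OF y_ge1[of x]] by (simp add: g\<psi>_def)
  qed
  then show ?thesis by simp
qed

text \<open>By the product rule, the gradient of \<open>R\<close> counts only where
  \<open>\<psi>\<close> is nonzero and is controlled by \<open>g_bound\<close> there; the gradient
  of \<open>\<psi>\<close> is charged to the tail.\<close>

lemma gG_bound: "norm (gG x) \<le> \<tau> / 2 * (G x * (s x)\<^sup>2) + 5 * (W x * indicator {x. r - 1 < s x} x)"
proof -
  have "\<psi> x * norm (g x) \<le> \<psi> x * (\<tau> / 2 * (s x)\<^sup>2)"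
  proof (cases "s x \<le> r")
    case True
    then show ?thesis using g_bound \<psi>_nonneg by (intro mult_left_mono)
  next
    case False
    then show ?thesis by (simp add: \<psi>_eq0)
  qed
  then have "W x * (\<psi> x * norm (g x)) \<le> W x * (\<psi> x * (\<tau> / 2 * (s x)\<^sup>2))"
    by (rule mult_left_mono[OF _ less_imp_le[OF W_pos]])
  moreover have "W x * norm (g\<psi> x) \<le> W x * (5 * indicator {x. r - 1 < s x} x)"
    using W_pos[of x] g\<psi>_bound by (intro mult_left_mono) auto
  moreover have "norm (gG x) \<le> W x * norm (g\<psi> x) + W x * (\<psi> x * norm (g x))"
    unfolding gG_def using W_pos[of x] \<psi>_nonneg[of x]
    by (intro order_trans[OF norm_triangle_ineq4]) (simp add: mult_ac)
  ultimately show ?thesis by (simp add: G_def mult_ac)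
qed

lemma G_le_W: "G x \<le> W x" and G_nonneg: "0 \<le> G x"
  using \<psi>_nonneg[of x] \<psi>_le1[of x] W_pos[of x] by (auto simp: G_def)

lemma G_meas [measurable]: "G \<in> borel_measurable borel"
  unfolding G_def[abs_def] by measurable

lemma G_integrable: "integrable N G"
  by (rule Bochner_Integration.integrable_bound[OF W_integrable])
     (use G_le_W G_nonneg W_pos in \<open>auto simp: abs_of_pos\<close>)

text \<open>\<open>\<tau> * s x \<le> 1 / 2\<close> trades one power of \<open>s x\<close> away,
  leaving a quadratic that the Gaussian weight can absorb.\<close>

lemma R_inner: "s x \<le> r \<Longrightarrow> \<bar>R x\<bar> \<le> (s x)\<^sup>2 / 12"
proof -
  assume *: "s x \<le> r"
  have "\<tau> * s x \<le> 1 / 2" using * \<tau>_nonneg \<tau>_r by (meson mult_left_mono order_trans)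
  then have "(\<tau> * s x) * (s x)\<^sup>2 \<le> 1 / 2 * (s x)\<^sup>2" by (intro mult_right_mono) auto
  with R_bound[OF *] show ?thesis by (simp add: power3_eq_cube power2_eq_square mult_ac)
qed

section \<open>The tail outside the radius \<open>r - 1\<close>, summed over shells of width
  one\<close>

lemma tail_pointwise:
  assumes "r - 1 + real j < s x" "s x \<le> r + real j"
  shows "W x \<le> exp (r\<^sup>2 / 12 + r * real j / 4 + (real j)\<^sup>2 / 2)"
proof -
  have "- (r\<^sup>2 / 12 + r * real j / 4 + (real j)\<^sup>2 / 2) \<le> R x"
  proof (cases "r \<le> s x")
    case True
    have "r * (s x - r) \<le> r * real j" using assms r6 by (intro mult_left_mono) auto
    moreover have "(s x - r)\<^sup>2 \<le> (real j)\<^sup>2" using assms True by (intro power_mono) auto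
    ultimately show ?thesis using R_outer[OF True] by linarith
  next
    \<comment> \<open>Only the shell \<open>j = 0\<close> reaches below the radius \<open>r\<close>,
      and there \<open>R_inner\<close> suffices.\<close>
    case False
    then have "(s x)\<^sup>2 \<le> r\<^sup>2" by (intro power_mono) auto
    moreover have "0 \<le> r * real j" using r6 by simp
    ultimately show ?thesis using R_inner[of x] False zero_le_power2[of "real j"] by linarith
  qed
  then show ?thesis by (simp add: W_def)
qed

text \<open>The bound for the innermost shell: \<open>exp (r\<^sup>2 / 12)\<close> for the weight,
  times the Gaussian tail beyond \<open>r - 1\<close>.\<close>

definition "B = exp (r\<^sup>2 / 12 - (r - 1 - a)\<^sup>2 / 2)"

text \<open>The squares of \<open>j\<close> in the growth and in the Gaussian tail cancel. What
  remains is linear in \<open>j\<close> with slope at most \<open>- 2\<close>, because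
  \<open>r\<close> is at least \<open>3 * a + 3\<close>, and \<open>exp (- 2)\<close> is at most
  \<open>1 / 4\<close>.\<close>

lemma tail_term: "exp (r\<^sup>2 / 12 + r * real j / 4 + (real j)\<^sup>2 / 2) * exp (- (r - 1 + real j - a)\<^sup>2 / 2) \<le> B * (1 / 4) ^ j"
proof -
  have e2: "exp (- 2 :: real) \<le> 1 / 4"
  proof -
    have "4 \<le> exp (1::real) * exp 1"
      using exp_ge_add_one_self[of "1::real"] mult_mono[of 2 "exp (1::real)" 2 "exp 1"] by simp
    then show ?thesis by (simp add: mult_exp_exp exp_minus field_simps)
  qed
  have "2 \<le> 3 * r / 4 - 1 - a" using r_ge norm_M by linarith
  then have "2 * real j \<le> (3 * r / 4 - 1 - a) * real j" by (intro mult_right_mono) auto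
  then have "r\<^sup>2 / 12 + r * real j / 4 + (real j)\<^sup>2 / 2 + (- (r - 1 + real j - a)\<^sup>2 / 2)
      \<le> (r\<^sup>2 / 12 - (r - 1 - a)\<^sup>2 / 2) + real j * - 2"
  proof -
    have "(r - 1 + real j - a)\<^sup>2 = (r - 1 - a)\<^sup>2 + 2 * ((r - 1 - a) * real j) + (real j)\<^sup>2"
      by (simp add: power2_eq_square algebra_simps)
    moreover have "(3 * r / 4 - 1 - a) * real j = (r - 1 - a) * real j - r * real j / 4"
      by (simp add: algebra_simps)
    ultimately show ?thesis using \<open>2 * real j \<le> _\<close> by linarith
  qed
  then have "exp (r\<^sup>2 / 12 + r * real j / 4 + (real j)\<^sup>2 / 2) * exp (- (r - 1 + real j - a)\<^sup>2 / 2)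
      \<le> exp ((r\<^sup>2 / 12 - (r - 1 - a)\<^sup>2 / 2) + real j * - 2)"
    unfolding mult_exp_exp by simp
  also have "\<dots> = B * exp (-2) ^ j" by (simp only: exp_add B_def exp_of_nat_mult)
  also have "\<dots> \<le> B * (1 / 4) ^ j" using e2 by (intro mult_left_mono power_mono) (auto simp: B_def)
  finally show ?thesis .
qed

lemma tail_bound_ennreal: "(\<integral>\<^sup>+x. ennreal (W x * indicator {x. r - 1 < s x} x) \<partial>N) \<le> ennreal (4 / 3 * B)"
proof -
  define q where "q j = exp (r\<^sup>2 / 12 + r * real j / 4 + (real j)\<^sup>2 / 2)" for j :: nat
  define S where "S j = {x. r - 1 + real j < s x}" for j :: nat
  have [measurable]: "S j \<in> sets borel" for j unfolding S_def by measurable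
  have pw: "ennreal (W x * indicator {x. r - 1 < s x} x) \<le> (\<Sum>j. ennreal (q j) * indicator (S j) x)" for x
  proof (cases "r - 1 < s x")
    case True
    \<comment> \<open>The index of the shell containing \<open>x\<close>. The sets
      \<open>S j\<close> are nested and not shells, so summing over all \<open>j\<close> only
      overestimates; the geometric series gives the factor \<open>4 / 3\<close>.\<close>
    define j where "j = nat \<lceil>s x - r\<rceil>"
    have "0 \<le> \<lceil>s x - r\<rceil>" using True by linarith
    then have j: "real j = of_int \<lceil>s x - r\<rceil>" by (simp add: j_def)
    have 1: "r - 1 + real j < s x" "s x \<le> r + real j" unfolding j by linarith+
    define F :: "nat \<Rightarrow> ennreal" where "F j = ennreal (q j) * indicator (S j) x" for j
    have "ennreal (W x * indicator {x. r - 1 < s x} x) \<le> F j"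
      using True 1 tail_pointwise[OF 1] by (simp add: F_def S_def q_def ennreal_leI)
    also have "\<dots> \<le> (\<Sum>j. F j)"
      using sum_le_suminf[of F "{j}"] by (simp add: summableI)
    finally show ?thesis by (simp add: F_def)
  qed simp
  have "(\<integral>\<^sup>+x. ennreal (W x * indicator {x. r - 1 < s x} x) \<partial>N)
      \<le> (\<integral>\<^sup>+x. (\<Sum>j. ennreal (q j) * indicator (S j) x) \<partial>N)"
    by (intro nn_integral_mono pw)
  also have "\<dots> = (\<Sum>j. \<integral>\<^sup>+x. ennreal (q j) * indicator (S j) x \<partial>N)"
    by (intro nn_integral_suminf) measurable
  also have "\<dots> = (\<Sum>j. ennreal (q j) * emeasure N (S j))"
    by (intro suminf_cong) (simp add: nn_integral_cmult_indicator)
  also have "\<dots> \<le> (\<Sum>j. ennreal (B * (1 / 4) ^ j))"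
  proof (intro suminf_le summableI)
    fix j
    have "emeasure N (S j) \<le> ennreal (exp (- (r - 1 + real j - a)\<^sup>2 / 2))"
      unfolding S_def using r_ge norm_M M_nonzero by (intro std_gauss_tail M) auto
    then have "ennreal (q j) * emeasure N (S j) \<le> ennreal (q j) * ennreal (exp (- (r - 1 + real j - a)\<^sup>2 / 2))"
      by (intro mult_left_mono) auto
    also have "\<dots> \<le> ennreal (B * (1 / 4) ^ j)"
      using tail_term[of j] by (simp add: q_def ennreal_leI flip: ennreal_mult)
    finally show "ennreal (q j) * emeasure N (S j) \<le> ennreal (B * (1 / 4) ^ j)" .
  qed
  also have "\<dots> = ennreal (\<Sum>j. B * (1 / 4) ^ j)"
    by (intro suminf_ennreal2) (auto simp: B_def intro!: summable_mult summable_geometric)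
  also have "(\<Sum>j. B * (1 / 4) ^ j) = 4 / 3 * B"
    by (subst suminf_mult) (auto simp: suminf_geometric summable_geometric)
  finally show ?thesis .
qed

definition "T = (\<integral>x. W x * indicator {x. r - 1 < s x} x \<partial>N)"

lemma T_integrable: "integrable N (\<lambda>x. W x * indicator {x. r - 1 < s x} x)"
proof -
  have "{x. r - 1 < s x} \<in> sets N" by simp measurable
  from integrable_mult_indicator[OF this W_integrable] show ?thesis by (simp add: mult.commute)
qed

lemma T_nonneg: "0 \<le> T"
  unfolding T_def using W_pos by (intro integral_nonneg_AE) (auto simp: less_imp_le)

lemma T_le: "T \<le> 4 / 3 * B"
proof -
  have "ennreal T = (\<integral>\<^sup>+x. ennreal (W x * indicator {x. r - 1 < s x} x) \<partial>N)"
    unfolding T_def using W_pos T_integrable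
    by (intro nn_integral_eq_integral[symmetric]) (auto simp: less_imp_le)
  also have "\<dots> \<le> ennreal (4 / 3 * B)" by (rule tail_bound_ennreal)
  finally show ?thesis by (simp add: B_def)
qed

section \<open>Normalizing constants and the second moment\<close>

definition "Z = (\<integral>x. W x \<partial>N)"
definition "Z\<^sub>G = (\<integral>x. G x \<partial>N)"

text \<open>Up to radius \<open>r - 1\<close> the cutoff is \<open>1\<close> and \<open>G x\<close>
  is at least \<open>exp (- (s x)\<^sup>2 / 12)\<close>, a function of mean at least
  \<open>exp (- a\<^sup>2 / 12)\<close>. The part outside costs at most one percent of that.\<close>

lemma Z\<^sub>G_ge: "99 / 100 * exp (- a\<^sup>2 / 12) \<le> Z\<^sub>G"
proof -
  let ?S = "{x. r - 1 < s x}"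
  have [measurable]: "?S \<in> sets borel" by measurable
  have int: "integrable N (\<lambda>x. exp (- (s x)\<^sup>2 / 12))"
    by (rule N.integrable_const_bound[of _ 1]) auto
  have intS: "integrable N (indicator ?S :: _ \<Rightarrow> real)"
    by (intro integrable_real_indicator) (auto simp: N.emeasure_eq_measure)
  have "ennreal (exp (- a\<^sup>2 / 12)) \<le> (\<integral>\<^sup>+x. ennreal (exp (- (s x)\<^sup>2 / 12)) \<partial>N)"
    using std_gauss_exp_square_ge[OF M, of "1/6"] by simp
  also have "\<dots> = ennreal (\<integral>x. exp (- (s x)\<^sup>2 / 12) \<partial>N)"
    using int by (intro nn_integral_eq_integral) auto
  finally have 1: "exp (- a\<^sup>2 / 12) \<le> (\<integral>x. exp (- (s x)\<^sup>2 / 12) \<partial>N)"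
    by (subst (asm) ennreal_le_iff) (auto intro!: integral_nonneg_AE)
  have "ennreal (measure N ?S) \<le> ennreal (exp (- (r - 1 - a)\<^sup>2 / 2))"
    using std_gauss_tail[OF M, of "r - 1"] r_ge norm_M M_nonzero by (auto simp flip: N.emeasure_eq_measure)
  then have 2: "measure N ?S \<le> exp (- (r - 1 - a)\<^sup>2 / 2)" by simp
  \<comment> \<open>\<open>r - 1 - a\<close> is at least \<open>2 * a + 2\<close>, and
    \<open>1 \<le> a\<close> then leaves \<open>7\<close> to spare in the exponent;
    \<open>exp (- 7)\<close> is below \<open>1 / 100\<close>.\<close>
  have "exp (- (r - 1 - a)\<^sup>2 / 2) \<le> exp (- a\<^sup>2 / 12 - 7)"
  proof -
    have "(2 * a + 2)\<^sup>2 \<le> (r - 1 - a)\<^sup>2" using r_ge norm_M by (intro power_mono) auto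
    moreover have "(2 * a + 2)\<^sup>2 = 4 * a\<^sup>2 + 8 * a + 4" by (simp add: power2_eq_square algebra_simps)
    moreover have "1 \<le> a\<^sup>2" using norm_M by simp
    ultimately have "- (r - 1 - a)\<^sup>2 / 2 \<le> - a\<^sup>2 / 12 - 7" using norm_M by linarith
    then show ?thesis by simp
  qed
  also have "\<dots> \<le> 1 / 100 * exp (- a\<^sup>2 / 12)"
  proof -
    have "(2::real) ^ 7 \<le> exp 1 ^ 7" using exp_ge_add_one_self[of "1::real"] by (intro power_mono) auto
    also have "\<dots> = exp (7::real)" by (simp flip: exp_of_nat_mult)
    finally have "exp (- 7 :: real) \<le> 1 / 100" by (simp add: exp_minus field_simps)
    then have "exp (- a\<^sup>2 / 12) * exp (- 7) \<le> exp (- a\<^sup>2 / 12) * (1 / 100)" by (intro mult_left_mono) auto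
    then show ?thesis by (simp add: mult_exp_exp)
  qed
  finally have 3: "measure N ?S \<le> 1 / 100 * exp (- a\<^sup>2 / 12)" using 2 by linarith
  have "(\<integral>x. exp (- (s x)\<^sup>2 / 12) \<partial>N) - measure N ?S = (\<integral>x. exp (- (s x)\<^sup>2 / 12) - indicator ?S x \<partial>N)"
    using int intS by simp
  also have "\<dots> \<le> Z\<^sub>G"
    unfolding Z\<^sub>G_def
  proof (intro integral_mono G_integrable)
    fix x
    show "exp (- (s x)\<^sup>2 / 12) - indicator ?S x \<le> G x"
    proof (cases "r - 1 < s x")
      case True
      have "exp (- (s x)\<^sup>2 / 12) \<le> 1" by simp
      moreover have "indicator ?S x = (1 :: real)" using True by simp
      ultimately show ?thesis using G_nonneg[of x] by linarith
    next
      case False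
      then have "G x = W x" by (simp add: G_def \<psi>_eq1)
      then show ?thesis using False R_inner[of x] by (simp add: W_def)
    qed
  qed (use int intS in auto)
  finally show ?thesis using 1 3 by simp
qed

lemma Z\<^sub>G_pos: "0 < Z\<^sub>G"
  using Z\<^sub>G_ge by (meson exp_gt_zero less_le_trans mult_pos_pos zero_less_divide_iff zero_less_numeral)

lemma G_sq_integrable: "integrable N (\<lambda>x. G x * (s x)\<^sup>2)"
proof (rule Bochner_Integration.integrable_bound)
  show "integrable N (\<lambda>x. W x * r\<^sup>2)" using W_integrable by simp
  show "AE x in N. norm (G x * (s x)\<^sup>2) \<le> norm (W x * r\<^sup>2)"
  proof (rule AE_I2)
    fix x
    show "norm (G x * (s x)\<^sup>2) \<le> norm (W x * r\<^sup>2)"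
    proof (cases "s x \<le> r")
      case True
      then have "(s x)\<^sup>2 \<le> r\<^sup>2" by (intro power_mono) auto
      then show ?thesis using G_le_W[of x] G_nonneg[of x] W_pos[of x] by (simp add: abs_mult mult_mono)
    next
      case False
      then show ?thesis by (simp add: G_def \<psi>_eq0)
    qed
  qed
qed measurable

text \<open>Jensen's inequality for the probability measure with density proportional to \<open>G\<close>, in tangent
  form. The number \<open>m\<close> lies slightly above \<open>a\<^sup>2 (ln 2 / 2 + 1 / 12)\<close>, so that \<open>exp (- m)\<close> times the
  exponential moment \<open>2 powr (a\<^sup>2 / 2)\<close> is at most \<open>Z\<^sub>G\<close>.\<close>

lemma second_moment: "(\<integral>x. G x * (s x)\<^sup>2 \<partial>N) \<le> 27 / 10 * a\<^sup>2 * Z\<^sub>G"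
proof -
  define m where "m = 9 / 20 * a\<^sup>2"
  \<comment> \<open>The \<open>1 / 12\<close> from \<open>R_inner\<close> and the tilt
    \<open>1 / 6\<close> add up to \<open>1 / 4\<close>, the exponential moment with
    \<open>\<mu> = 1 / 2\<close>.\<close>
  have Gexp: "G x * exp ((s x)\<^sup>2 / 6) \<le> exp ((s x)\<^sup>2 / 4)" for x
  proof (cases "s x \<le> r")
    case True
    have "G x * exp ((s x)\<^sup>2 / 6) \<le> W x * exp ((s x)\<^sup>2 / 6)" using G_le_W by (intro mult_right_mono) auto
    also have "\<dots> \<le> exp ((s x)\<^sup>2 / 4)" using R_inner[OF True] by (simp add: W_def mult_exp_exp)
    finally show ?thesis .
  qed (simp add: G_def \<psi>_eq0)
  have le: "(\<integral>\<^sup>+x. ennreal (exp ((s x)\<^sup>2 / 4)) \<partial>N) \<le> ennreal (exp (a\<^sup>2 * ln 2 / 2))"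
    using std_gauss_exp_square_le[OF M, of "1/2"] by (simp add: ln_div)
  have int: "integrable N (\<lambda>x. exp ((s x)\<^sup>2 / 4))"
    by (rule integrableI_bounded) (use le in \<open>auto simp: less_top top_unique intro: le_less_trans\<close>)
  have "ennreal (\<integral>x. exp ((s x)\<^sup>2 / 4) \<partial>N) = (\<integral>\<^sup>+x. ennreal (exp ((s x)\<^sup>2 / 4)) \<partial>N)"
    using int by (intro nn_integral_eq_integral[symmetric]) auto
  with le have "ennreal (\<integral>x. exp ((s x)\<^sup>2 / 4) \<partial>N) \<le> ennreal (exp (a\<^sup>2 * ln 2 / 2))"
    by (simp only:)
  then have le': "(\<integral>x. exp ((s x)\<^sup>2 / 4) \<partial>N) \<le> exp (a\<^sup>2 * ln 2 / 2)"
    by (simp add: ennreal_le_iff)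
  have "exp (- m) * exp (a\<^sup>2 * ln 2 / 2) \<le> Z\<^sub>G"
  proof -
    have a2: "1 \<le> a\<^sup>2" using norm_M by simp
    \<comment> \<open>\<open>9 / 20 - 25 / 72 - 1 / 12 = 7 / 360\<close> exceeds
      \<open>1 / 75\<close>, and \<open>exp (- 1 / 75)\<close> is at most \<open>75 / 76\<close>,
      which makes up for the \<open>99 / 100\<close> in \<open>Z\<^sub>G_ge\<close>.\<close>
    have "a\<^sup>2 * ln 2 \<le> a\<^sup>2 * (25 / 36)" by (intro mult_left_mono ln2_le_25_over_36) auto
    then have "- m + a\<^sup>2 * ln 2 / 2 \<le> - a\<^sup>2 / 12 - 1 / 75" using a2 by (simp add: m_def)
    then have "exp (- m) * exp (a\<^sup>2 * ln 2 / 2) \<le> exp (- a\<^sup>2 / 12 - 1 / 75)"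
      unfolding mult_exp_exp by simp
    also have "\<dots> = exp (- a\<^sup>2 / 12) / exp (1 / 75)" by (rule exp_diff)
    also have "\<dots> \<le> exp (- a\<^sup>2 / 12) / (76 / 75)"
      using exp_ge_add_one_self[of "1/75::real"] by (intro divide_left_mono) auto
    also have "\<dots> \<le> 99 / 100 * exp (- a\<^sup>2 / 12)" by simp
    finally show ?thesis using Z\<^sub>G_ge by linarith
  qed
  moreover have "(\<integral>x. G x * (s x)\<^sup>2 \<partial>N) / 6 \<le> exp (- m) * (\<integral>x. exp ((s x)\<^sup>2 / 4) \<partial>N) + (m - 1) * Z\<^sub>G"
  proof -
    have "(\<integral>x. G x * (s x)\<^sup>2 / 6 \<partial>N) \<le> (\<integral>x. exp (- m) * exp ((s x)\<^sup>2 / 4) + (m - 1) * G x \<partial>N)"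
    proof (rule integral_mono)
      fix x
      \<comment> \<open>This is the tangent to the exponential at \<open>m\<close>. It leads to a
        normalized mean of \<open>(s x)\<^sup>2 / 6\<close> of at most \<open>m\<close>, and six
        times \<open>9 / 20\<close> is \<open>27 / 10\<close>.\<close>
      have "(s x)\<^sup>2 / 6 \<le> exp (- m) * exp ((s x)\<^sup>2 / 6) + (m - 1)"
      proof -
        have "1 + (- m + (s x)\<^sup>2 / 6) \<le> exp (- m) * exp ((s x)\<^sup>2 / 6)"
          unfolding mult_exp_exp by (rule exp_ge_add_one_self)
        then show ?thesis by linarith
      qed
      then have "G x * ((s x)\<^sup>2 / 6) \<le> G x * (exp (- m) * exp ((s x)\<^sup>2 / 6) + (m - 1))"
        using G_nonneg by (intro mult_left_mono)
      also have "\<dots> = exp (- m) * (G x * exp ((s x)\<^sup>2 / 6)) + (m - 1) * G x" by (simp add: algebra_simps)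
      also have "\<dots> \<le> exp (- m) * exp ((s x)\<^sup>2 / 4) + (m - 1) * G x"
        using Gexp by (intro add_right_mono mult_left_mono) auto
      finally show "G x * (s x)\<^sup>2 / 6 \<le> exp (- m) * exp ((s x)\<^sup>2 / 4) + (m - 1) * G x" by simp
    qed (use int G_integrable G_sq_integrable in auto)
    then show ?thesis using int G_integrable by (simp add: Z\<^sub>G_def)
  qed
  moreover have "exp (- m) * (\<integral>x. exp ((s x)\<^sup>2 / 4) \<partial>N) \<le> exp (- m) * exp (a\<^sup>2 * ln 2 / 2)"
    using le' by (intro mult_left_mono) auto
  ultimately have "(\<integral>x. G x * (s x)\<^sup>2 \<partial>N) / 6 \<le> m * Z\<^sub>G"
    unfolding left_diff_distrib by linarith
  then show ?thesis by (simp add: m_def)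
qed

section \<open>From the Poincare inequality to the total variation bound\<close>

lemma mean_deviation:
  "(\<integral>x. \<bar>G x - Z\<^sub>G\<bar> \<partial>N) \<le> sqrt (pi / 2) * (\<tau> / 2 * (27 / 10 * a\<^sup>2 * Z\<^sub>G) + 5 * T)"
proof -
  have int: "integrable N (\<lambda>x. \<tau> / 2 * (G x * (s x)\<^sup>2) + 5 * (W x * indicator {x. r - 1 < s x} x))"
    using G_sq_integrable T_integrable by auto
  have bnn: "0 \<le> \<tau> / 2 * (G x * (s x)\<^sup>2) + 5 * (W x * indicator {x. r - 1 < s x} x)" for x
    using gG_bound[of x] norm_ge_zero order_trans by blast
  have "ennreal (\<integral>x. \<bar>G x - Z\<^sub>G\<bar> \<partial>N) = (\<integral>\<^sup>+x. ennreal \<bar>G x - Z\<^sub>G\<bar> \<partial>N)"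
    using G_integrable by (intro nn_integral_eq_integral[symmetric]) auto
  \<comment> \<open>\<open>Z\<^sub>G\<close> is the mean of \<open>G\<close> over an independent
    copy; pulling that mean out of the absolute value gives the form needed for
    \<open>std_gauss_poincare_L1\<close>.\<close>
  also have "\<dots> \<le> (\<integral>\<^sup>+x. \<integral>\<^sup>+y. ennreal \<bar>G x - G y\<bar> \<partial>N \<partial>N)"
  proof (rule nn_integral_mono)
    fix x
    have "G x - Z\<^sub>G = (\<integral>y. G x - G y \<partial>N)" using G_integrable by (simp add: Z\<^sub>G_def N.prob_space[simplified])
    then have "ennreal \<bar>G x - Z\<^sub>G\<bar> = ennreal (norm (\<integral>y. G x - G y \<partial>N))" by simp
    also have "\<dots> \<le> (\<integral>\<^sup>+y. ennreal (norm (G x - G y)) \<partial>N)"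
      using G_integrable by (intro integral_norm_bound_ennreal) simp
    finally show "ennreal \<bar>G x - Z\<^sub>G\<bar> \<le> (\<integral>\<^sup>+y. ennreal \<bar>G x - G y\<bar> \<partial>N)" by simp
  qed
  also have "\<dots> \<le> ennreal (sqrt (pi / 2)) * (\<integral>\<^sup>+x. ennreal (norm (gG x)) \<partial>N)"
    by (rule std_gauss_poincare_L1[OF G_deriv gG_cont])
  also have "\<dots> \<le> ennreal (sqrt (pi / 2)) *
      (\<integral>\<^sup>+x. ennreal (\<tau> / 2 * (G x * (s x)\<^sup>2) + 5 * (W x * indicator {x. r - 1 < s x} x)) \<partial>N)"
    by (intro mult_left_mono nn_integral_mono ennreal_leI gG_bound) auto
  also have "\<dots> = ennreal (sqrt (pi / 2)) *
      ennreal (\<integral>x. \<tau> / 2 * (G x * (s x)\<^sup>2) + 5 * (W x * indicator {x. r - 1 < s x} x) \<partial>N)"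
    using int bnn by (subst nn_integral_eq_integral) auto
  also have "(\<integral>x. \<tau> / 2 * (G x * (s x)\<^sup>2) + 5 * (W x * indicator {x. r - 1 < s x} x) \<partial>N)
      = \<tau> / 2 * (\<integral>x. G x * (s x)\<^sup>2 \<partial>N) + 5 * T"
    unfolding T_def using G_sq_integrable T_integrable by simp
  also have "ennreal (sqrt (pi / 2)) * ennreal (\<tau> / 2 * (\<integral>x. G x * (s x)\<^sup>2 \<partial>N) + 5 * T)
     \<le> ennreal (sqrt (pi / 2)) * ennreal (\<tau> / 2 * (27 / 10 * a\<^sup>2 * Z\<^sub>G) + 5 * T)"
    using \<tau>_nonneg by (intro mult_left_mono ennreal_leI add_right_mono second_moment) auto
  also have "\<dots> = ennreal (sqrt (pi / 2) * (\<tau> / 2 * (27 / 10 * a\<^sup>2 * Z\<^sub>G) + 5 * T))"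
    using \<tau>_nonneg T_nonneg Z\<^sub>G_pos by (intro ennreal_mult[symmetric]) auto
  finally show ?thesis
    using \<tau>_nonneg T_nonneg Z\<^sub>G_pos by (subst (asm) ennreal_le_iff) auto
qed

text \<open>The \<open>1\<close> pays for replacing \<open>W\<close> by \<open>G\<close>. The
  \<open>71 / 20\<close> is the gradient bound \<open>5\<close> of the cutoff times
  \<open>71 / 100\<close>, an upper bound for \<open>sqrt (pi / 2) / 2\<close>.\<close>

lemma tail_final: "(1 + 71 / 20) * T / Z\<^sub>G \<le> 2 * exp (- (r - 3 * a)\<^sup>2 / 3)"
proof -
  define b where "b = a - 1"
  define c where "c = r - 3 * a - 3"
  have bc: "0 \<le> b" "0 \<le> c" using norm_M r_ge by (auto simp: b_def c_def)
  \<comment> \<open>In terms of \<open>b\<close> and \<open>c\<close>, right side minus left side is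
    a polynomial with nonnegative coefficients. Dividing by \<open>60\<close> yields the exponents
    needed, with \<open>114 / 60 = 19 / 10\<close> to spare.\<close>
  have "5 * r\<^sup>2 + 20 * (r - 3 * a)\<^sup>2 + 5 * a\<^sup>2 + 114 \<le> 30 * (r - 1 - a)\<^sup>2"
  proof -
    have ar: "a = b + 1" "r = c + 3 * b + 6" by (auto simp: b_def c_def)
    show ?thesis
      unfolding ar using bc mult_nonneg_nonneg[OF bc] mult_nonneg_nonneg[OF bc(1) bc(1)] mult_nonneg_nonneg[OF bc(2) bc(2)]
      by (simp add: power2_eq_square algebra_simps)
  qed
  then have "r\<^sup>2 / 12 - (r - 1 - a)\<^sup>2 / 2 + a\<^sup>2 / 12 \<le> - (r - 3 * a)\<^sup>2 / 3 - 19 / 10"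
    by simp
  then have "B * exp (a\<^sup>2 / 12) \<le> exp (- (r - 3 * a)\<^sup>2 / 3 - 19 / 10)"
    unfolding B_def mult_exp_exp by simp
  also have "\<dots> \<le> exp (- (r - 3 * a)\<^sup>2 / 3) / (361 / 100)"
  proof -
    have "(19 / 10)\<^sup>2 \<le> (exp (19 / 20) :: real)\<^sup>2"
      using exp_ge_add_one_self[of "19/20::real"] by (intro power_mono) auto
    then have "361 / 100 \<le> exp (19 / 10 :: real)" by (simp add: power2_eq_square mult_exp_exp)
    then show ?thesis unfolding exp_diff by (intro divide_left_mono) auto
  qed
  finally have 1: "B * exp (a\<^sup>2 / 12) \<le> exp (- (r - 3 * a)\<^sup>2 / 3) / (361 / 100)" .
  have "T / Z\<^sub>G \<le> (4 / 3 * B) / (99 / 100 * exp (- a\<^sup>2 / 12))"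
    using T_le T_nonneg Z\<^sub>G_ge by (intro frac_le) (auto simp: B_def)
  also have "\<dots> = 400 / 297 * (B * exp (a\<^sup>2 / 12))" by (simp add: exp_minus field_simps)
  also have "\<dots> \<le> 400 / 297 * (exp (- (r - 3 * a)\<^sup>2 / 3) / (361 / 100))"
    using 1 by (intro mult_left_mono) auto
  finally have "T / Z\<^sub>G \<le> 400 / 297 * (exp (- (r - 3 * a)\<^sup>2 / 3) / (361 / 100))" .
  then have "(1 + 71 / 20) * (T / Z\<^sub>G) \<le> (1 + 71 / 20) * (400 / 297 * (exp (- (r - 3 * a)\<^sup>2 / 3) / (361 / 100)))"
    by (intro mult_left_mono) auto
  also have "\<dots> \<le> 2 * exp (- (r - 3 * a)\<^sup>2 / 3)" by simp
  finally show ?thesis by simp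
qed

text \<open>A triangle inequality through the normalized \<open>G\<close>: passing from
  \<open>W\<close> to \<open>G\<close> costs \<open>T / Z\<^sub>G\<close>, and passing from
  \<open>G\<close> to the Gaussian costs half of \<open>mean_deviation\<close>, divided by
  \<open>Z\<^sub>G\<close>.\<close>

theorem total_variation_bound:
  assumes A: "A \<in> sets borel"
  shows "\<bar>(\<integral>x. indicator A x * exp (- R x) \<partial>N) / (\<integral>x. exp (- R x) \<partial>N) - measure N A\<bar>
    \<le> \<tau> * a\<^sup>2 + 2 * exp (- (r - 3 * a)\<^sup>2 / 3)"
proof -
  define wA where "wA = (\<integral>x. indicator A x * W x \<partial>N)"
  define gA where "gA = (\<integral>x. indicator A x * G x \<partial>N)"
  have AN: "A \<in> sets N" using A by simp
  note iA = integrable_mult_indicator[OF AN, where 'b=real, simplified]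
  have D: "(\<integral>x. W x - G x \<partial>N) = Z - Z\<^sub>G" using W_integrable G_integrable by (simp add: Z_def Z\<^sub>G_def)
  have DA: "(\<integral>x. indicator A x * (W x - G x) \<partial>N) = wA - gA"
    using iA[OF W_integrable] iA[OF G_integrable] by (simp add: wA_def gA_def right_diff_distrib)
  have le1: "wA - gA \<le> Z - Z\<^sub>G" unfolding D[symmetric] DA[symmetric]
    using iA[of "\<lambda>x. W x - G x"] W_integrable G_integrable G_le_W
    by (intro integral_mono) (auto split: split_indicator)
  have ge1: "0 \<le> wA - gA" unfolding DA[symmetric] using G_le_W
    by (intro integral_nonneg_AE) (auto split: split_indicator)
  have gA: "0 \<le> gA" "gA \<le> Z\<^sub>G"
    unfolding gA_def Z\<^sub>G_def using iA[OF G_integrable] G_integrable G_nonneg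
    by (auto intro!: integral_nonneg_AE integral_mono split: split_indicator)
  have DT: "Z - Z\<^sub>G \<le> T"
    unfolding D[symmetric] T_def
  proof (intro integral_mono T_integrable)
    fix x show "W x - G x \<le> W x * indicator {x. r - 1 < s x} x"
      using G_nonneg[of x] by (auto simp: G_def \<psi>_eq1 split: split_indicator)
  qed (use W_integrable G_integrable in auto)
  have ZZ: "Z\<^sub>G \<le> Z" using le1 ge1 by linarith
  have Zp: "0 < Z" using ZZ Z\<^sub>G_pos by linarith
  \<comment> \<open>Over the denominator \<open>Z\<close> this is \<open>wA - gA\<close> minus the
    fraction \<open>gA / Z\<^sub>G\<close> of \<open>Z - Z\<^sub>G\<close>. Both terms lie between
    \<open>0\<close> and \<open>Z - Z\<^sub>G\<close>, hence so does the absolute value of their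
    difference.\<close>
  have "\<bar>wA / Z - gA / Z\<^sub>G\<bar> \<le> (Z - Z\<^sub>G) / Z"
  proof -
    have "gA / Z\<^sub>G \<le> 1" "0 \<le> gA / Z\<^sub>G" using gA Z\<^sub>G_pos by auto
    then have "gA / Z\<^sub>G * (Z - Z\<^sub>G) \<le> Z - Z\<^sub>G" "0 \<le> gA / Z\<^sub>G * (Z - Z\<^sub>G)"
      using ZZ by (intro mult_left_le_one_le mult_nonneg_nonneg; simp)+
    then have "\<bar>(wA - gA) - gA / Z\<^sub>G * (Z - Z\<^sub>G)\<bar> \<le> Z - Z\<^sub>G" using le1 ge1 by linarith
    moreover have "wA / Z - gA / Z\<^sub>G = ((wA - gA) - gA / Z\<^sub>G * (Z - Z\<^sub>G)) / Z"
      using Zp Z\<^sub>G_pos by (simp add: field_simps)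
    ultimately show ?thesis using Zp by (simp add: divide_right_mono)
  qed
  also have "\<dots> \<le> T / Z\<^sub>G" using DT ZZ Z\<^sub>G_pos by (intro frac_le) auto
  finally have 1: "\<bar>wA / Z - gA / Z\<^sub>G\<bar> \<le> T / Z\<^sub>G" .
  have iGZ: "integrable N (\<lambda>x. G x - Z\<^sub>G)" using G_integrable by simp
  have "(\<integral>x. indicator A x * (G x - Z\<^sub>G) \<partial>N) = gA - Z\<^sub>G * measure N A"
    using iA[OF G_integrable] iA[of "\<lambda>_. Z\<^sub>G"] AN by (simp add: gA_def right_diff_distrib)
  moreover have "(\<integral>x. G x - Z\<^sub>G \<partial>N) = 0"
    using G_integrable by (simp add: Z\<^sub>G_def N.prob_space[simplified])
  ultimately have "\<bar>gA - Z\<^sub>G * measure N A\<bar> \<le> (\<integral>x. \<bar>G x - Z\<^sub>G\<bar> \<partial>N) / 2"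
    using abs_integral_indicator_le[OF iGZ _ AN] by simp
  also have "\<dots> \<le> (sqrt (pi / 2) / 2) * (\<tau> / 2 * (27 / 10 * a\<^sup>2 * Z\<^sub>G) + 5 * T)"
    using mean_deviation by simp
  also have "\<dots> \<le> 71 / 100 * (\<tau> / 2 * (27 / 10 * a\<^sup>2 * Z\<^sub>G) + 5 * T)"
  proof (rule mult_right_mono)
    have "sqrt (pi / 2) \<le> 142 / 100"
      using pi_less_4 by (intro real_le_lsqrt) (auto simp: power2_eq_square)
    then show "sqrt (pi / 2) / 2 \<le> 71 / 100" by simp
  qed (use \<tau>_nonneg T_nonneg Z\<^sub>G_pos in auto)
  \<comment> \<open>\<open>71 / 100 * 27 / 20\<close> is below \<open>1\<close>, which is what gives
    the coefficient \<open>1\<close> of \<open>\<tau> * a\<^sup>2\<close>.\<close>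
  also have "\<dots> \<le> \<tau> * a\<^sup>2 * Z\<^sub>G + 71 / 20 * T"
  proof -
    have "0 \<le> \<tau> * a\<^sup>2 * Z\<^sub>G" using \<tau>_nonneg Z\<^sub>G_pos by auto
    then show ?thesis by (simp add: algebra_simps)
  qed
  finally have "\<bar>gA - Z\<^sub>G * measure N A\<bar> / Z\<^sub>G \<le> (\<tau> * a\<^sup>2 * Z\<^sub>G + 71 / 20 * T) / Z\<^sub>G"
    using Z\<^sub>G_pos by (intro divide_right_mono) auto
  moreover have "\<bar>gA / Z\<^sub>G - measure N A\<bar> = \<bar>gA - Z\<^sub>G * measure N A\<bar> / Z\<^sub>G"
  proof -
    have "gA / Z\<^sub>G - measure N A = (gA - Z\<^sub>G * measure N A) / Z\<^sub>G"
      using Z\<^sub>G_pos by (simp add: field_simps)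
    then show ?thesis using Z\<^sub>G_pos by (simp add: abs_divide)
  qed
  moreover have "(\<tau> * a\<^sup>2 * Z\<^sub>G + 71 / 20 * T) / Z\<^sub>G = \<tau> * a\<^sup>2 + 71 / 20 * (T / Z\<^sub>G)"
    using Z\<^sub>G_pos by (simp add: add_divide_distrib)
  ultimately have 2: "\<bar>gA / Z\<^sub>G - measure N A\<bar> \<le> \<tau> * a\<^sup>2 + 71 / 20 * (T / Z\<^sub>G)" by simp
  have "\<bar>wA / Z - measure N A\<bar> \<le> \<tau> * a\<^sup>2 + (1 + 71 / 20) * T / Z\<^sub>G" using 1 2 by (simp add: algebra_simps)
  also have "\<dots> \<le> \<tau> * a\<^sup>2 + 2 * exp (- (r - 3 * a)\<^sup>2 / 3)" using tail_final by simp
  finally show ?thesis by (simp add: wA_def Z_def W_def)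
qed

end

section \<open>Taylor expansion at the minimizer\<close>

lemma pos_def_ker: "pos_def A \<Longrightarrow> A *v x = 0 \<Longrightarrow> x = 0"
  by (metis inner_zero_right less_irrefl pos_def_def)

lemma pos_def_invertible: "pos_def A \<Longrightarrow> invertible A"
  by (metis invertible_left_inverse matrix_left_invertible_ker pos_def_ker)

section \<open>The tensor norm relative to \<open>D\<close>\<close>

lemma tensor_pair_scaleR:
  "tensor_pair T (a *\<^sub>R u) v w = a * tensor_pair T u v w"
  "tensor_pair T u (a *\<^sub>R v) w = a * tensor_pair T u v w"
  "tensor_pair T u v (a *\<^sub>R w) = a * tensor_pair T u v w"
  by (simp_all add: tensor_pair_def sum_distrib_left mult_ac)

lemma tensor_pair_zero [simp]:
  "tensor_pair T 0 v w = 0" "tensor_pair T u 0 w = 0" "tensor_pair T u v 0 = 0"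
  by (simp_all add: tensor_pair_def)

lemma tensor_pair_bound:
  "tensor_pair T u v w \<le> (\<Sum>i\<in>UNIV. \<Sum>j\<in>UNIV. \<Sum>k\<in>UNIV. \<bar>T $ i $ j $ k\<bar>) * (norm u * norm v * norm w)"
proof -
  have "T $ i $ j $ k * u $ i * v $ j * w $ k \<le> \<bar>T $ i $ j $ k\<bar> * (norm u * norm v * norm w)" for i j k
  proof -
    have "T $ i $ j $ k * u $ i * v $ j * w $ k \<le> \<bar>T $ i $ j $ k\<bar> * (\<bar>u $ i\<bar> * \<bar>v $ j\<bar> * \<bar>w $ k\<bar>)"
      by (rule order_trans[OF abs_ge_self]) (simp add: abs_mult mult.assoc)
    also have "\<dots> \<le> \<bar>T $ i $ j $ k\<bar> * (norm u * norm v * norm w)"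
      by (intro mult_left_mono mult_mono component_le_norm_cart) auto
    finally show ?thesis .
  qed
  then show ?thesis
    unfolding tensor_pair_def sum_distrib_right by (intro sum_mono)
qed

lemma invertible_norm_bound:
  fixes D :: "real^'n^'n"
  assumes "invertible D"
  obtains C where "C > 0" "\<And>u. norm u \<le> C * norm (D *v u)"
proof -
  obtain B where B: "B ** D = mat 1" using assms by (auto simp: invertible_def)
  have "bounded_linear ((*v) B)" by (simp add: linear_conv_bounded_linear[symmetric])
  then obtain C where C: "C > 0" "\<And>x. norm (B *v x) \<le> norm x * C"
    using bounded_linear.pos_bounded by blast
  have "norm u \<le> C * norm (D *v u)" for u
    using C(2)[of "D *v u"] B by (simp add: matrix_vector_mul_assoc mult.commute)
  then show thesis using C(1) that by blast
qed

text \<open>A real \<open>Sup\<close> is an upper bound only of a set that is bounded above.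
  Invertibility of \<open>D\<close> bounds the admissible vectors, hence the pairing.\<close>

lemma tensor_norm_bdd_above:
  fixes D :: "real^'n^'n"
  assumes "invertible D"
  shows "bdd_above {tensor_pair T u v w | u v w. norm (D *v u) = 1 \<and> norm (D *v v) = 1 \<and> norm (D *v w) = 1}"
proof -
  obtain C where C: "C > 0" "\<And>u. norm u \<le> C * norm (D *v u)"
    by (rule invertible_norm_bound[OF assms], rule that)
  let ?S = "(\<Sum>i\<in>UNIV. \<Sum>j\<in>UNIV. \<Sum>k\<in>UNIV. \<bar>T $ i $ j $ k\<bar>)"
  have S: "0 \<le> ?S" by (intro sum_nonneg) auto
  have "tensor_pair T u v w \<le> ?S * (C * C * C)"
    if "norm (D *v u) = 1" "norm (D *v v) = 1" "norm (D *v w) = 1" for u v w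
  proof -
    have "norm u \<le> C" "norm v \<le> C" "norm w \<le> C" using C(2)[of u] C(2)[of v] C(2)[of w] that by auto
    then show ?thesis
      using C(1) S by (intro order_trans[OF tensor_pair_bound] mult_left_mono mult_mono) auto
  qed
  then show ?thesis by (intro bdd_aboveI[of _ "?S * (C * C * C)"]) auto
qed

text \<open>Each slot is normalized by homogeneity; a vector that \<open>D\<close> sends to zero is
  itself zero, and then both sides vanish.\<close>

lemma tensor_pair_le:
  fixes D :: "real^'n^'n"
  assumes D: "invertible D"
  shows "tensor_pair T u v w \<le> tensor_norm D T * (norm (D *v u) * norm (D *v v) * norm (D *v w))"
proof (cases "D *v u = 0 \<or> D *v v = 0 \<or> D *v w = 0")
  case True
  have "x = 0" if "D *v x = 0" for x
    using D that by (metis invertible_left_inverse matrix_left_invertible_ker)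
  then have "u = 0 \<or> v = 0 \<or> w = 0" using True by blast
  then show ?thesis by auto
next
  case False
  define n where "n x = x /\<^sub>R norm (D *v x)" for x
  have n: "norm (D *v n x) = 1" "x = norm (D *v x) *\<^sub>R n x" if "D *v x \<noteq> 0" for x
    using that by (simp_all add: n_def linear_scale[OF matrix_vector_mul_linear])
  have "tensor_pair T (n u) (n v) (n w) \<le> tensor_norm D T"
    unfolding tensor_norm_def using False n(1)
    by (intro cSup_upper tensor_norm_bdd_above D) blast
  then have "(norm (D *v u) * norm (D *v v) * norm (D *v w)) * tensor_pair T (n u) (n v) (n w)
      \<le> (norm (D *v u) * norm (D *v v) * norm (D *v w)) * tensor_norm D T"
    by (intro mult_left_mono) auto
  moreover have "tensor_pair T u v w = (norm (D *v u) * norm (D *v v) * norm (D *v w)) * tensor_pair T (n u) (n v) (n w)"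
    using False n(2)[of u] n(2)[of v] n(2)[of w]
    by (metis (no_types, lifting) mult.assoc tensor_pair_scaleR)
  ultimately show ?thesis by (simp add: mult.commute)
qed

lemma abs_tensor_pair_le:
  fixes D :: "real^'n^'n"
  assumes D: "invertible D"
  shows "\<bar>tensor_pair T u v w\<bar> \<le> tensor_norm D T * (norm (D *v u) * norm (D *v v) * norm (D *v w))"
proof (rule abs_leI[OF tensor_pair_le[OF D]])
  have "- tensor_pair T u v w = tensor_pair T ((-1) *\<^sub>R u) v w" by (simp only: tensor_pair_scaleR)
  also have "\<dots> \<le> tensor_norm D T * (norm (D *v ((-1) *\<^sub>R u)) * norm (D *v v) * norm (D *v w))"
    by (rule tensor_pair_le[OF D])
  finally show "- tensor_pair T u v w \<le> tensor_norm D T * (norm (D *v u) * norm (D *v v) * norm (D *v w))"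
    by (simp only: linear_scale[OF matrix_vector_mul_linear] norm_scaleR)
qed

lemma tensor_norm_nonneg:
  fixes D :: "real^'n^'n"
  assumes D: "invertible D"
  shows "0 \<le> tensor_norm D T"
proof -
  obtain k :: 'n where True by simp
  let ?e = "axis k 1 :: real^'n"
  have "D *v ?e \<noteq> 0"
    using D by (metis invertible_left_inverse matrix_left_invertible_ker axis_eq_0_iff zero_neq_one)
  then have "0 < norm (D *v ?e) * norm (D *v ?e) * norm (D *v ?e)" by simp
  moreover have "0 \<le> tensor_norm D T * (norm (D *v ?e) * norm (D *v ?e) * norm (D *v ?e))"
    using abs_tensor_pair_le[OF D, of T ?e ?e ?e] by linarith
  ultimately show ?thesis by (simp add: zero_le_mult_iff)
qed

section \<open>Coordinate forms of the derivatives, and comparison along lines\<close>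

lemma gradient_has_derivative:
  fixes f :: "real^'n \<Rightarrow> real"
  assumes "f differentiable (at x)"
  shows "(f has_derivative (\<lambda>h. gradient f x \<bullet> h)) (at x)"
proof -
  let ?F = "frechet_derivative f (at x)"
  have F: "(f has_derivative ?F) (at x)" using assms by (simp add: frechet_derivative_works)
  then have lin: "linear ?F" by (rule has_derivative_linear)
  have "?F h = gradient f x \<bullet> h" for h
  proof -
    have "?F h = ?F (\<Sum>i\<in>UNIV. h $ i *\<^sub>R axis i 1)"
      using basis_expansion[of h] by (simp add: scalar_mult_eq_scaleR)
    also have "\<dots> = gradient f x \<bullet> h"
      by (simp add: linear_sum[OF lin] linear_scale[OF lin] gradient_def inner_vec_def mult.commute)
    finally show ?thesis .
  qed
  then have "?F = (\<lambda>h. gradient f x \<bullet> h)" by (rule ext)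
  with F show ?thesis by simp
qed

lemma hessian_has_derivative:
  fixes f :: "real^'n \<Rightarrow> real"
  assumes "gradient f differentiable (at x)"
  shows "(gradient f has_derivative (\<lambda>h. hessian f x *v h)) (at x)"
proof -
  let ?F = "frechet_derivative (gradient f) (at x)"
  have F: "(gradient f has_derivative ?F) (at x)" using assms by (simp add: frechet_derivative_works)
  then have "linear ?F" by (rule has_derivative_linear)
  then have "?F = (\<lambda>h. hessian f x *v h)" by (simp add: hessian_def matrix_works fun_eq_iff)
  with F show ?thesis by simp
qed

text \<open>Fixing \<open>v\<close> and \<open>w\<close> makes the Hessian a scalar function, to
  which one-variable comparison applies. The direction of differentiation takes the first slot of
  the tensor.\<close>

lemma third_deriv_has_derivative:
  fixes f :: "real^'n \<Rightarrow> real"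
  assumes "hessian f differentiable (at x)"
  shows "((\<lambda>x. v \<bullet> (hessian f x *v w)) has_derivative (\<lambda>h. tensor_pair (third_deriv f x) h v w)) (at x)"
proof -
  let ?F = "frechet_derivative (hessian f) (at x)"
  have F: "(hessian f has_derivative ?F) (at x)" using assms by (simp add: frechet_derivative_works)
  then have lin: "linear ?F" by (rule has_derivative_linear)
  have bl: "bounded_linear (\<lambda>A :: real^'n^'n. v \<bullet> (A *v w))"
    by (simp add: linear_conv_bounded_linear[symmetric] linear_iff matrix_vector_mult_add_rdistrib
        inner_add_right scaleR_matrix_vector_assoc[symmetric])
  note lin' = bounded_linear.linear[OF bl]
  have "v \<bullet> (?F h *v w) = tensor_pair (third_deriv f x) h v w" for h
  proof -
    have "?F h = ?F (\<Sum>i\<in>UNIV. h $ i *\<^sub>R axis i 1)"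
      using basis_expansion[of h] by (simp add: scalar_mult_eq_scaleR)
    also have "\<dots> = (\<Sum>i\<in>UNIV. h $ i *\<^sub>R ?F (axis i 1))"
      by (simp add: linear_sum[OF lin] linear_scale[OF lin])
    finally have "v \<bullet> (?F h *v w) = (\<Sum>i\<in>UNIV. h $ i * (v \<bullet> (?F (axis i 1) *v w)))"
      using linear_sum[OF lin', of "\<lambda>i. h $ i *\<^sub>R ?F (axis i 1)" UNIV] by (simp add: linear_scale[OF lin'])
    also have "\<dots> = tensor_pair (third_deriv f x) h v w"
      by (simp add: tensor_pair_def third_deriv_def inner_vec_def matrix_vector_mult_def
          sum_distrib_left mult_ac)
    finally show ?thesis .
  qed
  then have "(\<lambda>h. v \<bullet> (?F h *v w)) = (\<lambda>h. tensor_pair (third_deriv f x) h v w)" by (rule ext)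
  with bounded_linear.has_derivative[OF bl F] show ?thesis by simp
qed

text \<open>Monotonicity of \<open>B - F\<close> replaces integration of derivatives: the third
  derivative merely exists and need not be continuous.\<close>

lemma diff_le_of_deriv_le:
  fixes F B :: "real \<Rightarrow> real"
  assumes "a \<le> b"
    and F: "\<And>t. a \<le> t \<Longrightarrow> t \<le> b \<Longrightarrow> (F has_real_derivative F' t) (at t)"
    and B: "\<And>t. a \<le> t \<Longrightarrow> t \<le> b \<Longrightarrow> (B has_real_derivative B' t) (at t)"
    and le: "\<And>t. a \<le> t \<Longrightarrow> t \<le> b \<Longrightarrow> F' t \<le> B' t"
  shows "F b - F a \<le> B b - B a"
proof -
  have "(\<lambda>t. B t - F t) a \<le> (\<lambda>t. B t - F t) b"
  proof (rule DERIV_nonneg_imp_nondecreasing[OF \<open>a \<le> b\<close>])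
    fix t assume "a \<le> t" "t \<le> b"
    then show "\<exists>y. ((\<lambda>t. B t - F t) has_real_derivative y) (at t) \<and> 0 \<le> y"
      using F B le by (intro exI[of _ "B' t - F' t"]) (auto intro!: DERIV_diff)
  qed
  then show ?thesis by simp
qed

lemma abs_diff_le_of_deriv_le:
  fixes F B :: "real \<Rightarrow> real"
  assumes "a \<le> b"
    and F: "\<And>t. a \<le> t \<Longrightarrow> t \<le> b \<Longrightarrow> (F has_real_derivative F' t) (at t)"
    and B: "\<And>t. a \<le> t \<Longrightarrow> t \<le> b \<Longrightarrow> (B has_real_derivative B' t) (at t)"
    and le: "\<And>t. a \<le> t \<Longrightarrow> t \<le> b \<Longrightarrow> \<bar>F' t\<bar> \<le> B' t"
  shows "\<bar>F b - F a\<bar> \<le> B b - B a"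
proof (rule abs_leI)
  show "F b - F a \<le> B b - B a"
    by (rule diff_le_of_deriv_le[OF assms(1) F B]) (use le abs_le_D1 in auto)
  have "(- F b) - (- F a) \<le> B b - B a"
  proof (rule diff_le_of_deriv_le[OF assms(1) _ B])
    fix t assume t: "a \<le> t" "t \<le> b"
    show "((\<lambda>t. - F t) has_real_derivative - F' t) (at t)" by (rule DERIV_minus[OF F[OF t]])
    show "- F' t \<le> B' t" using le[OF t] by linarith
  qed auto
  then show "- (F b - F a) \<le> B b - B a" by simp
qed

lemma has_real_derivative_along_line:
  fixes F :: "'a::real_normed_vector \<Rightarrow> real"
  assumes "(F has_derivative F') (at (c + t *\<^sub>R u))"
  shows "((\<lambda>t. F (c + t *\<^sub>R u)) has_real_derivative F' u) (at t)"
proof -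
  have "((\<lambda>t. c + t *\<^sub>R u) has_derivative (\<lambda>h. h *\<^sub>R u)) (at t)"
    by (auto intro!: derivative_eq_intros)
  from has_derivative_compose[OF this assms]
  have "((\<lambda>t. F (c + t *\<^sub>R u)) has_derivative (\<lambda>h. F' (h *\<^sub>R u))) (at t)" .
  then show ?thesis
    using linear_scale[OF has_derivative_linear[OF assms]]
    by (simp add: has_field_derivative_def mult_commute_abs)
qed

section \<open>The Taylor remainder along rays from the minimizer\<close>

locale taylor_remainder =
  fixes f :: "real^'n \<Rightarrow> real" and \<theta> :: "real^'n" and D :: "real^'n^'n" and \<tau> r :: real
  assumes f3: "three_times_differentiable f"
    and min: "\<And>x. f \<theta> \<le> f x"
    and D: "invertible D"
    and sym: "transpose (hessian f \<theta>) = hessian f \<theta>"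
    and third: "\<And>u. norm (D *v u) \<le> r \<Longrightarrow> tensor_norm D (third_deriv f (\<theta> + u)) \<le> \<tau>"
    and \<tau>: "0 \<le> \<tau>" and r: "0 < r"
begin

abbreviation "H \<equiv> hessian f \<theta>"

text \<open>The remainder after the quadratic term. The linear term is absent because the gradient
  vanishes at the minimizer.\<close>

definition "Q u = f (\<theta> + u) - f \<theta> - (u \<bullet> (H *v u)) / 2"
definition "q u = gradient f (\<theta> + u) - H *v u"

lemma f_deriv: "(f has_derivative (\<lambda>h. gradient f x \<bullet> h)) (at x)"
  and grad_deriv: "(gradient f has_derivative (\<lambda>h. hessian f x *v h)) (at x)"
  and hess_deriv: "((\<lambda>x. v \<bullet> (hessian f x *v w)) has_derivative (\<lambda>h. tensor_pair (third_deriv f x) h v w)) (at x)"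
  using f3 by (auto simp: three_times_differentiable_def differentiable_on_def
      intro!: gradient_has_derivative hessian_has_derivative third_deriv_has_derivative)

lemma H_sym: "(H *v u) \<bullet> v = u \<bullet> (H *v v)"
  using sym by (metis dot_lmul_matrix transpose_matrix_vector)

lemma gradient_min: "gradient f \<theta> = 0"
proof -
  have "(\<lambda>h. gradient f \<theta> \<bullet> h) = (\<lambda>h. 0)"
    by (rule differential_zero_maxmin[where S=UNIV, OF _ _ f_deriv[of \<theta>]]) (use min in auto)
  then have "gradient f \<theta> \<bullet> gradient f \<theta> = 0" by metis
  then show ?thesis by simp
qed

lemma Q_deriv: "(Q has_derivative (\<lambda>h. q u \<bullet> h)) (at u)"
proof -
  have 1: "((\<lambda>u. f (\<theta> + u)) has_derivative (\<lambda>h. gradient f (\<theta> + u) \<bullet> h)) (at u)"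
  proof -
    have "((\<lambda>u. \<theta> + u) has_derivative (\<lambda>h. h)) (at u)" by (auto intro!: derivative_eq_intros)
    from has_derivative_compose[OF this f_deriv] show ?thesis .
  qed
  have 2: "((*v) H has_derivative (*v) H) (at u)"
    by (simp add: bounded_linear_imp_has_derivative linear_conv_bounded_linear[symmetric])
  have "((\<lambda>u. f (\<theta> + u) - f \<theta> - (u \<bullet> (H *v u)) / 2) has_derivative
      (\<lambda>h. gradient f (\<theta> + u) \<bullet> h - (u \<bullet> (H *v h) + h \<bullet> (H *v u)) / 2)) (at u)"
    by (auto intro!: derivative_eq_intros 1 2)
  moreover have "gradient f (\<theta> + u) \<bullet> h - (u \<bullet> (H *v h) + h \<bullet> (H *v u)) / 2 = q u \<bullet> h" for h
    by (simp only: q_def inner_diff_left H_sym[of u h, symmetric] inner_commute[of h "H *v u"]) simp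
  ultimately show ?thesis unfolding Q_def[abs_def] by simp
qed

lemma q_deriv: "(q has_derivative (\<lambda>h. (hessian f (\<theta> + u) - H) *v h)) (at u)"
proof -
  have "((\<lambda>u. \<theta> + u) has_derivative (\<lambda>h. h)) (at u)" by (auto intro!: derivative_eq_intros)
  from has_derivative_compose[OF this grad_deriv]
  have 1: "((\<lambda>u. gradient f (\<theta> + u)) has_derivative (\<lambda>h. hessian f (\<theta> + u) *v h)) (at u)" .
  have 2: "((*v) H has_derivative (*v) H) (at u)"
    by (simp add: bounded_linear_imp_has_derivative linear_conv_bounded_linear[symmetric])
  from has_derivative_diff[OF 1 2] show ?thesis
    unfolding q_def[abs_def] by (simp add: matrix_vector_mult_diff_rdistrib)
qed

lemma q_cont: "continuous_on UNIV q"
  using q_deriv by (meson continuous_at_imp_continuous_on has_derivative_continuous)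

lemma Q_line: "((\<lambda>t. Q (t *\<^sub>R u)) has_real_derivative q (t *\<^sub>R u) \<bullet> u) (at t)"
  using has_real_derivative_along_line[of Q _ 0 t u, OF Q_deriv[of "0 + t *\<^sub>R u"]] by simp

lemma q_line: "((\<lambda>t. q (t *\<^sub>R u) \<bullet> w) has_real_derivative w \<bullet> ((hessian f (\<theta> + t *\<^sub>R u) - H) *v u)) (at t)"
  using has_real_derivative_along_line[of "\<lambda>u. q u \<bullet> w" _ 0 t u, OF has_derivative_inner_left[OF q_deriv[of "0 + t *\<^sub>R u"]]]
  by (simp add: inner_commute)

text \<open>The third derivative is at most \<open>\<tau>\<close> along the whole segment from
  \<open>\<theta>\<close> to \<open>\<theta> + u\<close>, which stays in the ball.
  \<open>q_bound\<close> and \<open>Q_bound\<close> integrate once and twice more, whence their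
  constants \<open>1 / 2\<close> and \<open>1 / 6\<close>.\<close>

lemma hessian_bound:
  assumes "norm (D *v u) \<le> r"
  shows "\<bar>v \<bullet> ((hessian f (\<theta> + u) - H) *v w)\<bar> \<le> \<tau> * (norm (D *v u) * norm (D *v v) * norm (D *v w))"
proof -
  let ?\<phi> = "\<lambda>t. v \<bullet> (hessian f (\<theta> + t *\<^sub>R u) *v w)"
  let ?c = "\<tau> * (norm (D *v u) * norm (D *v v) * norm (D *v w))"
  have "\<bar>?\<phi> 1 - ?\<phi> 0\<bar> \<le> ?c * 1 - ?c * 0"
  proof (rule abs_diff_le_of_deriv_le)
    fix t :: real assume t: "0 \<le> t" "t \<le> 1"
    show "(?\<phi> has_real_derivative tensor_pair (third_deriv f (\<theta> + t *\<^sub>R u)) u v w) (at t)"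
      by (rule has_real_derivative_along_line[OF hess_deriv])
    show "((*) ?c has_real_derivative ?c) (at t)"
      by (auto intro!: derivative_eq_intros)
    have "norm (D *v (t *\<^sub>R u)) = t * norm (D *v u)" using t by (simp add: linear_scale[OF matrix_vector_mul_linear])
    also have "\<dots> \<le> norm (D *v u)" using t by (simp add: mult_left_le_one_le)
    finally have "tensor_norm D (third_deriv f (\<theta> + t *\<^sub>R u)) \<le> \<tau>" using assms by (intro third) simp
    then have "tensor_norm D (third_deriv f (\<theta> + t *\<^sub>R u)) * (norm (D *v u) * norm (D *v v) * norm (D *v w)) \<le> ?c"
      by (intro mult_right_mono) auto
    then show "\<bar>tensor_pair (third_deriv f (\<theta> + t *\<^sub>R u)) u v w\<bar> \<le> ?c"
      using abs_tensor_pair_le[OF D] order_trans by blast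
  qed auto
  then show ?thesis by (simp add: matrix_vector_mult_diff_rdistrib inner_diff_right)
qed

lemma D_scale: "norm (D *v (t *\<^sub>R u)) = \<bar>t\<bar> * norm (D *v u)"
  by (simp add: linear_scale[OF matrix_vector_mul_linear])

lemma q_bound:
  assumes u: "norm (D *v u) \<le> r"
  shows "\<bar>q u \<bullet> w\<bar> \<le> \<tau> / 2 * (norm (D *v u))\<^sup>2 * norm (D *v w)"
proof -
  let ?\<phi> = "\<lambda>t. q (t *\<^sub>R u) \<bullet> w"
  let ?c = "\<tau> * (norm (D *v u))\<^sup>2 * norm (D *v w)"
  have "\<bar>?\<phi> 1 - ?\<phi> 0\<bar> \<le> ?c * 1\<^sup>2 / 2 - ?c * 0\<^sup>2 / 2"
  proof (rule abs_diff_le_of_deriv_le)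
    fix t :: real assume t: "0 \<le> t" "t \<le> 1"
    show "(?\<phi> has_real_derivative w \<bullet> ((hessian f (\<theta> + t *\<^sub>R u) - H) *v u)) (at t)"
      by (rule q_line)
    show "((\<lambda>t. ?c * t\<^sup>2 / 2) has_real_derivative ?c * t) (at t)"
      by (auto intro!: derivative_eq_intros)
    have "t * norm (D *v u) \<le> r" using t u by (smt (verit) mult_left_le_one_le norm_ge_zero)
    then show "\<bar>w \<bullet> ((hessian f (\<theta> + t *\<^sub>R u) - H) *v u)\<bar> \<le> ?c * t"
      using hessian_bound[of "t *\<^sub>R u" w u] t by (simp add: D_scale power2_eq_square mult_ac)
  qed auto
  moreover have "q 0 = 0" by (simp add: q_def gradient_min)
  ultimately show ?thesis by simp
qed

lemma Q_bound:
  assumes u: "norm (D *v u) \<le> r"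
  shows "\<bar>Q u\<bar> \<le> \<tau> / 6 * (norm (D *v u))^3"
proof -
  let ?\<phi> = "\<lambda>t. Q (t *\<^sub>R u)"
  let ?c = "\<tau> * (norm (D *v u))^3"
  have "\<bar>?\<phi> 1 - ?\<phi> 0\<bar> \<le> ?c * 1^3 / 6 - ?c * 0^3 / 6"
  proof (rule abs_diff_le_of_deriv_le)
    fix t :: real assume t: "0 \<le> t" "t \<le> 1"
    show "(?\<phi> has_real_derivative q (t *\<^sub>R u) \<bullet> u) (at t)"
      by (rule Q_line)
    show "((\<lambda>t. ?c * t^3 / 6) has_real_derivative ?c * t\<^sup>2 / 2) (at t)"
      by (auto intro!: derivative_eq_intros)
    have "t * norm (D *v u) \<le> r" using t u by (smt (verit) mult_left_le_one_le norm_ge_zero)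
    then show "\<bar>q (t *\<^sub>R u) \<bullet> u\<bar> \<le> ?c * t\<^sup>2 / 2"
      using q_bound[of "t *\<^sub>R u" u] t by (simp add: D_scale power2_eq_square power3_eq_cube mult_ac)
  qed auto
  moreover have "Q 0 = 0" by (simp add: Q_def)
  ultimately show ?thesis by simp
qed

text \<open>Along the ray through \<open>u\<close>, the cubic bounds with
  \<open>\<tau> * r \<le> 1 / 2\<close> give value at least \<open>- r\<^sup>2 / 12\<close> and
  slope at least \<open>- r / 4\<close> at radius \<open>r\<close>. Beyond it the second derivative
  in the direction \<open>\<omega>\<close> is at least \<open>- 1\<close>; integrating twice gives
  the claim.\<close>

lemma Q_outer:
  assumes u: "r \<le> norm (D *v u)" and \<tau>r: "\<tau> * r \<le> 1 / 2"
    and low: "\<And>x v. - (norm (D *v v))\<^sup>2 \<le> v \<bullet> ((hessian f x - H) *v v)"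
  shows "- (r\<^sup>2 / 12 + r * (norm (D *v u) - r) / 4 + (norm (D *v u) - r)\<^sup>2 / 2) \<le> Q u"
proof -
  define s where "s = norm (D *v u)"
  define \<omega> where "\<omega> = u /\<^sub>R s"
  have s: "r \<le> s" "0 < s" using u r by (auto simp: s_def)
  have D\<omega>: "norm (D *v \<omega>) = 1" using s by (simp add: \<omega>_def D_scale s_def)
  have u\<omega>: "u = s *\<^sub>R \<omega>" using s by (simp add: \<omega>_def)
  have r\<omega>: "norm (D *v (r *\<^sub>R \<omega>)) = r" using r by (simp add: D_scale D\<omega>)
  have "\<bar>Q (r *\<^sub>R \<omega>)\<bar> \<le> \<tau> / 6 * r ^ 3" using Q_bound[of "r *\<^sub>R \<omega>"] r\<omega> by simp
  also have "\<dots> = (\<tau> * r) * r\<^sup>2 / 6" by (simp add: power2_eq_square power3_eq_cube)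
  also have "\<dots> \<le> 1 / 2 * r\<^sup>2 / 6" using \<tau>r by (intro divide_right_mono mult_right_mono) auto
  finally have Qr: "- r\<^sup>2 / 12 \<le> Q (r *\<^sub>R \<omega>)" by simp
  have "\<bar>q (r *\<^sub>R \<omega>) \<bullet> \<omega>\<bar> \<le> \<tau> / 2 * r\<^sup>2" using q_bound[of "r *\<^sub>R \<omega>" \<omega>] r\<omega> D\<omega> by simp
  also have "\<dots> = (\<tau> * r) * r / 2" by (simp add: power2_eq_square)
  also have "\<dots> \<le> 1 / 2 * r / 2" using \<tau>r r by (intro divide_right_mono mult_right_mono) auto
  finally have qr: "- r / 4 \<le> q (r *\<^sub>R \<omega>) \<bullet> \<omega>" by simp
  have qt: "- r / 4 - (t - r) \<le> q (t *\<^sub>R \<omega>) \<bullet> \<omega>" if "r \<le> t" for t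
  proof -
    have "(- t) - (- r) \<le> q (t *\<^sub>R \<omega>) \<bullet> \<omega> - q (r *\<^sub>R \<omega>) \<bullet> \<omega>"
    proof (rule diff_le_of_deriv_le[OF that, of uminus "\<lambda>_. -1"])
      fix t
      show "(uminus has_real_derivative - 1) (at t)" by (auto intro!: derivative_eq_intros)
      show "((\<lambda>t. q (t *\<^sub>R \<omega>) \<bullet> \<omega>) has_real_derivative \<omega> \<bullet> ((hessian f (\<theta> + t *\<^sub>R \<omega>) - H) *v \<omega>)) (at t)"
        by (rule q_line)
      show "- 1 \<le> \<omega> \<bullet> ((hessian f (\<theta> + t *\<^sub>R \<omega>) - H) *v \<omega>)"
        using low[of \<omega> "\<theta> + t *\<^sub>R \<omega>"] D\<omega> by simp
    qed
    then show ?thesis using qr by simp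
  qed
  let ?B = "\<lambda>t. - r / 4 * t - (t - r)\<^sup>2 / 2"
  have "?B s - ?B r \<le> Q (s *\<^sub>R \<omega>) - Q (r *\<^sub>R \<omega>)"
  proof (rule diff_le_of_deriv_le[OF s(1)])
    fix t
    show "(?B has_real_derivative - r / 4 - (t - r)) (at t)"
      by (auto intro!: derivative_eq_intros simp: field_simps)
    show "((\<lambda>t. Q (t *\<^sub>R \<omega>)) has_real_derivative q (t *\<^sub>R \<omega>) \<bullet> \<omega>) (at t)" by (rule Q_line)
  qed (use qt in auto)
  then have "- (r\<^sup>2 / 12 + r * (s - r) / 4 + (s - r)\<^sup>2 / 2) \<le> Q (s *\<^sub>R \<omega>)"
    using Qr by (simp add: algebra_simps diff_divide_distrib)
  then show ?thesis unfolding u\<omega>[symmetric] by (simp only: s_def)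
qed

end

section \<open>Change of coordinates\<close>

lemma matrix_inv_unique:
  fixes A B :: "'a::semiring_1^'n^'n"
  assumes "A ** B = mat 1" "B ** A = mat 1"
  shows "matrix_inv A = B"
proof -
  have "A ** matrix_inv A = mat 1 \<and> matrix_inv A ** A = mat 1"
    unfolding matrix_inv_def by (rule someI[of _ B]) (simp add: assms)
  then show ?thesis
    using assms by (metis matrix_mul_assoc matrix_mul_lid matrix_mul_rid)
qed

lemma norm_transpose: "norm (transpose A) = norm A" for A :: "real^'n^'m"
proof -
  have "(norm (transpose A))\<^sup>2 = (norm A)\<^sup>2"
    unfolding norm_matrix_sq by (subst sum.swap) (simp add: transpose_def)
  then show ?thesis by simp
qed

lemma norm_matrix_vector_mult_le: "norm (A *v x) \<le> norm A * norm x" for A :: "real^'n^'m"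
proof -
  have "norm (A *v x) = L2_set (\<lambda>i. norm ((A *v x) $ i)) UNIV" by (simp add: norm_vec_def)
  also have "\<dots> \<le> L2_set (\<lambda>i. norm (A $ i) * norm x) UNIV"
  proof (rule L2_set_mono)
    fix i
    have "(A *v x) $ i = A $ i \<bullet> x" by (simp add: matrix_vector_mult_def inner_vec_def)
    then show "norm ((A *v x) $ i) \<le> norm (A $ i) * norm x" by (simp add: Cauchy_Schwarz_ineq2)
  qed simp
  also have "\<dots> = norm A * norm x" by (simp add: L2_set_left_distrib norm_vec_def[of A])
  finally show ?thesis .
qed

lemma trace_transpose_mult: "trace (transpose M ** M) = (norm M)\<^sup>2" for M :: "real^'n^'n"
  unfolding norm_matrix_sq
  by (subst sum.swap) (simp add: trace_def matrix_matrix_mult_def transpose_def power2_eq_square)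

lemma op_norm_bound: "norm (A *v x) \<le> op_norm A * norm x" for A :: "real^'n^'m"
  unfolding op_norm_def by (intro onorm) (simp add: linear_conv_bounded_linear[symmetric])

lemma op_norm_le_norm: "op_norm A \<le> norm A" for A :: "real^'n^'m"
  unfolding op_norm_def by (intro onorm_le norm_matrix_vector_mult_le)

lemma det_diagonalized:
  fixes A P :: "real^'n^'n"
  assumes P: "orthogonal_matrix P" and d: "\<And>z. A *v (P *v z) = P *v (\<chi> i. d i * z $ i)"
  shows "det A = (\<Prod>i\<in>UNIV. d i)"
proof -
  let ?D = "(\<chi> i j. if i = j then d i else 0) :: real^'n^'n"
  have Dz: "?D *v z = (\<chi> i. d i * z $ i)" for z
    by (simp add: matrix_vector_mult_def vec_eq_iff if_distrib[where f="\<lambda>x. x * _"] cong: if_cong)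
  have "A ** P = P ** ?D"
    unfolding matrix_eq by (intro allI) (simp only: matrix_vector_mul_assoc[symmetric] Dz d)
  then have "det (A ** P) = det (P ** ?D)" by (rule arg_cong)
  then have "det A * det P = det P * det ?D" by (simp only: det_mul)
  moreover have "det P \<noteq> 0" using det_orthogonal_matrix[OF P] by auto
  moreover have "det ?D = (\<Prod>i\<in>UNIV. d i)" by (subst det_diagonal) auto
  ultimately show ?thesis by simp
qed

text \<open>After diagonalizing \<open>A\<close>, the orthogonal factors preserve Lebesgue measure
  and the diagonal factor scales each coordinate by \<open>d i\<close>, whose product is the
  determinant.\<close>

lemma nn_integral_lborel_symmetric_affine:
  fixes A :: "real^'n^'n"
  assumes sym: "transpose A = A" and det: "det A \<noteq> 0" and [measurable]: "F \<in> borel_measurable borel"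
  shows "(\<integral>\<^sup>+x. F x \<partial>lborel) = ennreal \<bar>det A\<bar> * (\<integral>\<^sup>+z. F (c + A *v z) \<partial>lborel)"
proof -
  obtain P d where P: "orthogonal_matrix P" and d: "\<And>z. A *v (P *v z) = P *v (\<chi> i. d i * z $ i)"
    using symmetric_matrix_diagonalize[OF sym] by blast
  have detA: "det A = (\<Prod>i\<in>UNIV. d i)" by (rule det_diagonalized[OF P d])
  then have d0: "d i \<noteq> 0" for i using det by auto
  have ot: "orthogonal_transformation ((*v) P)" using P by (simp add: orthogonal_transformation_matrix)
  have inj: "inj (\<lambda>i::'n. axis i (1::real))" by (simp add: inj_def axis_eq_axis)
  define k :: "real^'n \<Rightarrow> 'n" where "k b = (SOME i. b = axis i 1)" for b
  have k: "k (axis i 1) = i" for i by (auto simp: k_def axis_eq_axis)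
  define S where "S z = 0 + (\<Sum>j\<in>Basis. (d (k j) * (z \<bullet> j)) *\<^sub>R j)" for z :: "real^'n"
  have S: "S z = (\<chi> i. d i * z $ i)" for z
  proof -
    have "S z $ i = (\<Sum>j\<in>UNIV. (d j * z $ j) * axis j 1 $ i)" for i
      by (simp add: S_def Basis_vec_eq_axis sum.reindex[OF inj] k inner_axis)
    then show ?thesis
      by (simp add: vec_eq_iff axis_def if_distrib[where f="\<lambda>x. _ * x"] cong: if_cong)
  qed
  have [measurable]: "S \<in> borel_measurable borel" unfolding S_def by measurable
  have lb: "lborel = density (distr lborel borel S) (\<lambda>_. ennreal \<bar>det A\<bar>)"
  proof -
    have "(\<Prod>j\<in>Basis. \<bar>d (k j)\<bar>) = \<bar>det A\<bar>"
      by (simp add: Basis_vec_eq_axis prod.reindex[OF inj] k detA abs_prod)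
    then show ?thesis
      unfolding S_def[abs_def]
      using lborel_affine_euclidean[of "\<lambda>j. d (k j)" "0 :: real^'n"] d0 by simp
  qed
  have "(\<integral>\<^sup>+x. F x \<partial>lborel) = (\<integral>\<^sup>+x. F (c + x) \<partial>lborel)"
    using nn_integral_lborel_translate[of F c] by (simp add: add.commute)
  also have "\<dots> = (\<integral>\<^sup>+x. F (c + P *v x) \<partial>lborel)"
    by (rule nn_integral_lborel_orthogonal[OF ot, symmetric]) measurable
  also have "\<dots> = ennreal \<bar>det A\<bar> * (\<integral>\<^sup>+z. F (c + P *v (S z)) \<partial>lborel)"
    by (subst lb) (simp add: nn_integral_density nn_integral_distr nn_integral_cmult)
  also have "(\<integral>\<^sup>+z. F (c + P *v (S z)) \<partial>lborel) = (\<integral>\<^sup>+z. F (c + A *v (P *v z)) \<partial>lborel)"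
    by (simp add: S d)
  also have "\<dots> = (\<integral>\<^sup>+z. F (c + A *v z) \<partial>lborel)"
    by (rule nn_integral_lborel_orthogonal[OF ot]) measurable
  finally show ?thesis .
qed

lemma total_variation_le:
  assumes "sets \<mu> = sets \<nu>" "\<And>A. A \<in> sets \<mu> \<Longrightarrow> \<bar>measure \<mu> A - measure \<nu> A\<bar> \<le> b"
  shows "total_variation \<mu> \<nu> \<le> b"
  unfolding total_variation_def by (intro cSUP_least) (use assms sets.empty_sets in auto)

section \<open>Transfer of the bound to the Gibbs measure and its Laplace approximation\<close>

theorem corollary2p7:
  fixes f :: "real^'n \<Rightarrow> real" and \<theta> :: "real^'n" and DG D :: "real^'n^'n" and r :: real
  assumes "three_times_differentiable f"
    and "integrable lborel (\<lambda>x. exp (- f x))"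
    and "\<And>x. x \<noteq> \<theta> \<Longrightarrow> f \<theta> < f x"
    and "pos_def (hessian f \<theta>)"
    and "pos_def DG" and "DG ** DG = hessian f \<theta>"
    and "pos_def D"
    and "alpha DG D = 1"
    and "\<And>x. pos_semidef (hessian f x - (DG ** DG - D ** D))"
    and "r \<ge> 3 * sqrt (eff_dim DG D) + 3"
    and "ereal r * third_deriv_sup f \<theta> D r \<le> ereal (1 / 2)"
  shows "ereal (total_variation (gibbs_measure f) (gaussian_measure \<theta> (matrix_inv (DG ** DG))))
    \<le> third_deriv_sup f \<theta> D r * ereal (eff_dim DG D)
       + ereal (2 * exp (- (r - 3 * sqrt (eff_dim DG D))\<^sup>2 / 3))"
proof -
  define A where "A = matrix_inv DG"
  \<comment> \<open>Chosen so that the norm of \<open>M *v z\<close> is that of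
    \<open>D *v u\<close> for \<open>u = A *v z\<close>. The matrix \<open>A ** D\<close> in
    \<open>alpha\<close> is the transpose of \<open>M\<close>.\<close>
  define M where "M = D ** A"
  have invDG: "invertible DG" and invD: "invertible D"
    using assms(5,7) by (simp_all add: pos_def_invertible)
  have symDG: "transpose DG = DG" and symD: "transpose D = D"
    using assms(5,7) by (simp_all add: pos_def_def)
  have DGA: "DG ** A = mat 1" and ADG: "A ** DG = mat 1"
    unfolding A_def using invDG by (metis invertible_def matrix_inv_unique)+
  have symA: "transpose A = A"
  proof -
    have "transpose A ** DG = mat 1" using DGA symDG by (metis matrix_transpose_mul transpose_mat)
    then show ?thesis using DGA by (metis matrix_mul_assoc matrix_mul_lid matrix_mul_rid)
  qed
  have AvDG: "A *v (DG *v x) = x" and DGvA: "DG *v (A *v x) = x" for x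
    using DGA ADG by (simp_all add: matrix_vector_mul_assoc)
  have tM: "transpose M = A ** D" by (simp add: M_def matrix_transpose_mul symA symD)
  have op1: "op_norm (transpose M) = 1" using assms(8) by (simp add: alpha_def tM A_def)
  have contr: "norm (M *v x) \<le> norm x" for x
  proof -
    have "(norm (M *v x))\<^sup>2 = x \<bullet> (transpose M *v (M *v x))"
      by (metis dot_lmul_matrix dot_square_norm inner_commute transpose_matrix_vector)
    also have "\<dots> \<le> norm x * norm (transpose M *v (M *v x))" by (rule norm_cauchy_schwarz)
    also have "\<dots> \<le> norm x * norm (M *v x)"
      using op_norm_bound[of "transpose M" "M *v x"] op1 by (intro mult_left_mono) auto
    finally show ?thesis by (cases "M *v x = 0") (auto simp: power2_eq_square)
  qed
  have normM: "1 \<le> norm M"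
    using op_norm_le_norm[of "transpose M"] op1 by (simp add: norm_transpose)
  have HAA: "(DG ** DG) ** (A ** A) = mat 1" and AAH: "(A ** A) ** (DG ** DG) = mat 1"
    using DGA ADG by (metis matrix_mul_assoc matrix_mul_rid)+
  have invH: "matrix_inv (DG ** DG) = A ** A"
    by (rule matrix_inv_unique[OF HAA AAH])
  \<comment> \<open>The denominator is \<open>1\<close> as \<open>alpha DG D = 1\<close>, and
    cyclicity of the trace turns the numerator into the trace of
    \<open>transpose M ** M\<close>.\<close>
  have eff: "eff_dim DG D = (norm M)\<^sup>2"
  proof -
    have "eff_dim DG D = trace (A ** A ** (D ** D))"
      using op1 tM by (simp add: eff_dim_def A_def invH)
    also have "\<dots> = trace ((A ** D ** D) ** A)"
    proof -
      have "A ** A ** (D ** D) = A ** (A ** D ** D)" by (simp only: matrix_mul_assoc)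
      then show ?thesis using trace_mul_sym[of A "A ** D ** D"] by simp
    qed
    also have "\<dots> = trace (transpose M ** M)" 
      unfolding tM by (simp only: M_def matrix_mul_assoc)
    finally show ?thesis by (simp add: trace_transpose_mult)
  qed
  have sq: "sqrt (eff_dim DG D) = norm M" by (simp add: eff)
  have r: "3 * norm M + 3 \<le> r" using assms(10) by (simp add: sq)
  have r0: "0 < r" using r normM by linarith
  let ?S = "third_deriv_sup f \<theta> D r"
  have le_S: "ereal (tensor_norm D (third_deriv f (\<theta> + u))) \<le> ?S" if "norm (D *v u) \<le> r" for u
    unfolding third_deriv_sup_def using that by (intro SUP_upper) auto
  have S0: "0 \<le> ?S"
  proof -
    have "0 \<le> ereal (tensor_norm D (third_deriv f (\<theta> + 0)))"
      using tensor_norm_nonneg[OF invD] by simp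
    also have "\<dots> \<le> ?S" using r0 by (intro le_S) simp
    finally show ?thesis .
  qed
  \<comment> \<open>An infinite supremum times \<open>r > 0\<close> would violate the bound
    \<open>1 / 2\<close>, so the supremum is a real number.\<close>
  obtain \<tau> where S\<tau>: "?S = ereal \<tau>"
    using assms(11) S0 r0 by (cases ?S) auto
  have \<tau>0: "0 \<le> \<tau>" using S0 S\<tau> by simp
  have \<tau>r: "\<tau> * r \<le> 1 / 2" using assms(11) S\<tau> by (simp add: mult.commute)
  interpret T: taylor_remainder f \<theta> D \<tau> r
  proof
    show "f \<theta> \<le> f x" for x using assms(3)[of x] by (cases "x = \<theta>") auto
    show "transpose (hessian f \<theta>) = hessian f \<theta>" using assms(4) by (simp add: pos_def_def)
    show "tensor_norm D (third_deriv f (\<theta> + u)) \<le> \<tau>" if "norm (D *v u) \<le> r" for u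
      using le_S[OF that] S\<tau> by simp
  qed (use assms(1) invD \<tau>0 r0 in auto)
  have low: "- (norm (D *v v))\<^sup>2 \<le> v \<bullet> ((hessian f x - T.H) *v v)" for x v
  proof -
    have "0 \<le> v \<bullet> ((hessian f x - (DG ** DG - D ** D)) *v v)"
      using assms(9)[of x] by (simp add: pos_semidef_def)
    also have "\<dots> = v \<bullet> ((hessian f x - T.H) *v v) + v \<bullet> (D *v (D *v v))"
      by (simp add: assms(6) matrix_vector_mult_diff_rdistrib inner_diff_right matrix_vector_mul_assoc)
    also have "v \<bullet> (D *v (D *v v)) = (norm (D *v v))\<^sup>2"
      using symD by (metis dot_lmul_matrix dot_square_norm transpose_matrix_vector)
    finally show ?thesis by simp
  qed
  have adj: "(transpose B *v x) \<bullet> y = x \<bullet> (B *v y)" for B :: "real^'n^'n" and x y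
    by (metis dot_lmul_matrix transpose_matrix_vector)
  have DG_adj: "x \<bullet> (DG *v y) = (DG *v x) \<bullet> y" for x y
    using adj[of DG x y] by (simp only: symDG)
  define R where "R z = T.Q (A *v z)" for z
  define g where "g z = transpose A *v T.q (A *v z)" for z
  have Mz: "M *v z = D *v (A *v z)" for z by (simp add: M_def matrix_vector_mul_assoc)
  have Rderiv: "(R has_derivative (\<lambda>h. g z \<bullet> h)) (at z)" for z
  proof -
    have "((*v) A has_derivative (*v) A) (at z)"
      by (simp add: bounded_linear_imp_has_derivative linear_conv_bounded_linear[symmetric])
    from has_derivative_compose[OF this T.Q_deriv]
    have "(R has_derivative (\<lambda>h. T.q (A *v z) \<bullet> (A *v h))) (at z)"
      unfolding R_def[abs_def] .
    moreover have "(\<lambda>h. g z \<bullet> h) = (\<lambda>h. T.q (A *v z) \<bullet> (A *v h))"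
      by (rule ext) (simp only: g_def adj)
    ultimately show ?thesis by simp
  qed
  \<comment> \<open>\<open>A\<close> inverts the square root \<open>DG\<close> of the Hessian, so
    the quadratic Taylor term becomes that of the standard Gaussian.\<close>
  have f_eq: "f (\<theta> + A *v z) = f \<theta> + (norm z)\<^sup>2 / 2 + R z" for z
  proof -
    have "(A *v z) \<bullet> (T.H *v (A *v z)) = (A *v z) \<bullet> (DG *v z)"
      by (simp only: DGvA assms(6)[symmetric] matrix_vector_mul_assoc[symmetric])
    also have "\<dots> = z \<bullet> z" by (simp only: DG_adj DGvA)
    finally show ?thesis by (simp add: R_def T.Q_def power2_norm_eq_inner)
  qed
  have contA: "continuous_on UNIV (\<lambda>z. A *v z)" by (rule matrix_vector_mult_linear_continuous_on)
  have mf [measurable]: "f \<in> borel_measurable borel"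
    using T.f_deriv by (intro borel_measurable_continuous_onI)
      (meson continuous_at_imp_continuous_on has_derivative_continuous)
  have mR [measurable]: "R \<in> borel_measurable borel"
    using Rderiv by (intro borel_measurable_continuous_onI)
      (meson continuous_at_imp_continuous_on has_derivative_continuous)
  let ?N = "std_gauss :: (real^'n) measure"
  define K where "K = sqrt (2 * pi) ^ CARD('n)"
  have K: "0 < K" by (simp add: K_def)
  define E where "E = (\<lambda>z. \<theta> + A *v z)"
  have [measurable]: "E \<in> borel_measurable borel" unfolding E_def by measurable
  have detA: "det A \<noteq> 0" using ADG by (metis det_I det_mul mult_zero_left zero_neq_one)
  have change_var: "(\<integral>\<^sup>+x. F x \<partial>lborel) = ennreal \<bar>det A\<bar> * (\<integral>\<^sup>+z. F (E z) \<partial>lborel)"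
    if "F \<in> borel_measurable borel" for F
    unfolding E_def by (rule nn_integral_lborel_symmetric_affine[OF symA detA that])
  \<comment> \<open>\<open>c\<close> collects the Jacobian, the minimal value of \<open>f\<close>
    and the Gaussian normalization; it cancels in the probabilities.\<close>
  define c where "c = \<bar>det A\<bar> * exp (- f \<theta>) * K"
  have c: "0 < c" using detA K by (simp add: c_def)
  have trans: "(\<integral>\<^sup>+x. ennreal (indicator B x * exp (- f x)) \<partial>lborel)
      = ennreal c * (\<integral>\<^sup>+z. ennreal (indicator (E -` B) z * exp (- R z)) \<partial>?N)"
    if B[measurable]: "B \<in> sets borel" for B
  proof -
    have [measurable]: "E -` B \<in> sets borel" using measurable_sets[of E borel borel B] by simp
    have "(\<integral>\<^sup>+x. ennreal (indicator B x * exp (- f x)) \<partial>lborel)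
        = ennreal \<bar>det A\<bar> * (\<integral>\<^sup>+z. ennreal (indicator B (E z) * exp (- f (E z))) \<partial>lborel)"
      by (rule change_var) measurable
    also have "(\<integral>\<^sup>+z. ennreal (indicator B (E z) * exp (- f (E z))) \<partial>lborel)
       = (\<integral>\<^sup>+z. ennreal (exp (- f \<theta>) * K) * (ennreal (gauss_density z) * ennreal (indicator (E -` B) z * exp (- R z))) \<partial>lborel)"
    proof (rule nn_integral_cong)
      fix z
      have "indicator B (E z) * exp (- f (E z)) = exp (- f \<theta>) * K * (gauss_density z * (indicator (E -` B) z * exp (- R z)))"
      proof -
        have "exp (- f (E z)) = exp (- f \<theta>) * exp (- (norm z)\<^sup>2 / 2) * exp (- R z)"
          unfolding mult_exp_exp by (simp add: E_def f_eq)
        moreover have "indicator B (E z) = (indicator (E -` B) z :: real)" by (simp add: indicator_def)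
        ultimately show ?thesis using K by (simp add: gauss_density_def K_def)
      qed
      then show "ennreal (indicator B (E z) * exp (- f (E z)))
        = ennreal (exp (- f \<theta>) * K) * (ennreal (gauss_density z) * ennreal (indicator (E -` B) z * exp (- R z)))"
        using K by (simp flip: ennreal_mult)
    qed
    also have "\<dots> = ennreal (exp (- f \<theta>) * K) * (\<integral>\<^sup>+z. ennreal (indicator (E -` B) z * exp (- R z)) \<partial>?N)"
      by (simp add: nn_integral_cmult nn_integral_std_gauss)
    finally show ?thesis using K by (simp only: c_def mult.assoc ennreal_mult abs_ge_zero exp_ge_zero mult_nonneg_nonneg less_imp_le)
  qed
  have intR: "integrable ?N (\<lambda>z. exp (- R z))"
  proof (rule integrableI_bounded)
    have "ennreal c * (\<integral>\<^sup>+z. ennreal (norm (exp (- R z))) \<partial>?N) = (\<integral>\<^sup>+x. ennreal (exp (- f x)) \<partial>lborel)"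
      using trans[of UNIV] by simp
    also have "\<dots> < \<infinity>" using assms(2) by (simp add: integrable_iff_bounded)
    finally show "(\<integral>\<^sup>+z. ennreal (norm (exp (- R z))) \<partial>?N) < \<infinity>"
      using c by (auto simp: ennreal_mult_less_top)
  qed measurable
  interpret G: gauss_perturbation M R g \<tau> r
  proof
    show "continuous_on UNIV g"
      unfolding g_def
      by (intro continuous_on_compose2[OF matrix_vector_mult_linear_continuous_on]
          continuous_on_compose2[OF T.q_cont] contA) auto
    show "norm (g x) \<le> \<tau> / 2 * (norm (M *v x))\<^sup>2" if "norm (M *v x) \<le> r" for x
    proof -
      \<comment> \<open>Testing \<open>q\<close> against \<open>A *v g x\<close> produces the
        squared norm of \<open>g x\<close>; contraction by \<open>M\<close> then lets one factor be
        divided out.\<close>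
      have "(norm (g x))\<^sup>2 = T.q (A *v x) \<bullet> (A *v g x)"
        by (simp only: dot_square_norm[symmetric] g_def adj)
      also have "\<dots> \<le> \<tau> / 2 * (norm (M *v x))\<^sup>2 * norm (M *v g x)"
        using T.q_bound[of "A *v x" "A *v g x"] that by (simp add: Mz)
      also have "\<dots> \<le> \<tau> / 2 * (norm (M *v x))\<^sup>2 * norm (g x)"
        using \<tau>0 by (intro mult_left_mono contr) auto
      finally show ?thesis using \<tau>0 by (cases "g x = 0") (auto simp: power2_eq_square)
    qed
    show "\<bar>R x\<bar> \<le> \<tau> / 6 * (norm (M *v x))^3" if "norm (M *v x) \<le> r" for x
      using T.Q_bound[of "A *v x"] that by (simp add: Mz R_def)
    show "- (r\<^sup>2 / 12 + r * (norm (M *v x) - r) / 4 + (norm (M *v x) - r)\<^sup>2 / 2) \<le> R x"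
      if "r \<le> norm (M *v x)" for x
      using T.Q_outer[of "A *v x"] that \<tau>r low by (simp add: Mz R_def)
  qed (use contr normM Rderiv \<tau>0 r \<tau>r intR in auto)
  let ?G = "gaussian_measure \<theta> (matrix_inv (DG ** DG))"
  have "total_variation (gibbs_measure f) ?G \<le> \<tau> * (norm M)\<^sup>2 + 2 * exp (- (r - 3 * norm M)\<^sup>2 / 3)"
  proof (rule total_variation_le)
    show "sets (gibbs_measure f) = sets ?G"
      by (simp add: gibbs_measure_def gaussian_measure_def)
    fix B assume "B \<in> sets (gibbs_measure f)"
    then have B [measurable]: "B \<in> sets borel" by (simp add: gibbs_measure_def)
    have EB [measurable]: "E -` B \<in> sets borel" using measurable_sets[of E borel borel B] by simp
    have I: "(\<integral>x. indicator C x * exp (- f x) \<partial>lborel) = c * (\<integral>z. indicator (E -` C) z * exp (- R z) \<partial>?N)"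
      if [measurable]: "C \<in> sets borel" for C
    proof -
      have [measurable]: "E -` C \<in> sets borel" using measurable_sets[of E borel borel C] by simp
      show ?thesis
        using c by (simp add: integral_eq_nn_integral trans[OF that] enn2real_mult)
    qed
    define Zf where "Zf = (\<integral>x. exp (- f x) \<partial>lborel)"
    have Zf: "Zf = c * G.Z" using I[of UNIV] by (simp add: Zf_def G.Z_def G.W_def)
    have GZ: "0 < G.Z"
    proof -
      have "G.Z\<^sub>G \<le> G.Z" unfolding G.Z_def G.Z\<^sub>G_def
        by (intro integral_mono G.G_integrable G.W_integrable G.G_le_W)
      then show ?thesis using G.Z\<^sub>G_pos by linarith
    qed
    have Zfp: "0 < Zf" using Zf c GZ by simp
    have "measure (gibbs_measure f) B = (\<integral>x. indicator B x * exp (- f x) \<partial>lborel) / Zf"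
    proof -
      have "measure (gibbs_measure f) B = enn2real (\<integral>\<^sup>+x. ennreal (exp (- f x) / Zf) * indicator B x \<partial>lborel)"
        unfolding gibbs_measure_def Zf_def[symmetric] measure_def by (subst emeasure_density) auto
      also have "\<dots> = enn2real (\<integral>\<^sup>+x. ennreal (indicator B x * exp (- f x) / Zf) \<partial>lborel)"
        by (intro arg_cong[where f=enn2real] nn_integral_cong) (auto split: split_indicator)
      also have "\<dots> = (\<integral>x. indicator B x * exp (- f x) / Zf \<partial>lborel)"
        using Zfp by (intro integral_eq_nn_integral[symmetric]) auto
      finally show ?thesis by simp
    qed
    also have "\<dots> = (\<integral>z. indicator (E -` B) z * exp (- R z) \<partial>?N) / (\<integral>z. exp (- R z) \<partial>?N)"
      using c by (simp add: I[OF B] Zf G.Z_def G.W_def)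
    finally have gibbs: "measure (gibbs_measure f) B
      = (\<integral>z. indicator (E -` B) z * exp (- R z) \<partial>?N) / (\<integral>z. exp (- R z) \<partial>?N)" .
    have gauss: "measure ?G B = measure ?N (E -` B)"
    proof -
      let ?Sig = "matrix_inv (DG ** DG)"
      have ii: "matrix_inv ?Sig = DG ** DG"
        unfolding invH by (rule matrix_inv_unique[OF AAH HAA])
      \<comment> \<open>The covariance is \<open>A ** A\<close>, so the root of its determinant is
        the Jacobian of the substitution and cancels against it.\<close>
      have norm_const: "sqrt ((2 * pi) ^ CARD('n) * det ?Sig) = K * \<bar>det A\<bar>"
        by (simp add: invH det_mul real_sqrt_mult real_sqrt_power K_def power_mult_distrib)
      have quad: "(A *v z) \<bullet> ((DG ** DG) *v (A *v z)) = (norm z)\<^sup>2" for z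
      proof -
        have "(A *v z) \<bullet> ((DG ** DG) *v (A *v z)) = (A *v z) \<bullet> (DG *v z)"
          by (simp only: DGvA matrix_vector_mul_assoc[symmetric])
        also have "\<dots> = z \<bullet> z" by (simp only: DG_adj DGvA)
        finally show ?thesis by (simp only: dot_square_norm)
      qed
      have "emeasure ?G B = (\<integral>\<^sup>+x. ennreal (exp (- ((x - \<theta>) \<bullet> ((DG ** DG) *v (x - \<theta>))) / 2) / (K * \<bar>det A\<bar>)) * indicator B x \<partial>lborel)"
        unfolding gaussian_measure_def ii norm_const by (subst emeasure_density) auto
      also have "\<dots> = ennreal \<bar>det A\<bar> * (\<integral>\<^sup>+z. ennreal (exp (- ((E z - \<theta>) \<bullet> ((DG ** DG) *v (E z - \<theta>))) / 2) / (K * \<bar>det A\<bar>)) * indicator B (E z) \<partial>lborel)"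
        by (rule change_var) measurable
      also have "\<dots> = (\<integral>\<^sup>+z. ennreal \<bar>det A\<bar> * (ennreal (exp (- ((E z - \<theta>) \<bullet> ((DG ** DG) *v (E z - \<theta>))) / 2) / (K * \<bar>det A\<bar>)) * indicator B (E z)) \<partial>lborel)"
        by (rule nn_integral_cmult[symmetric]) measurable
      also have "\<dots> = (\<integral>\<^sup>+z. ennreal (gauss_density z) * indicator (E -` B) z \<partial>lborel)"
      proof (rule nn_integral_cong)
        fix z :: "real^'n"
        have "\<bar>det A\<bar> * (exp (- (norm z)\<^sup>2 / 2) / (K * \<bar>det A\<bar>)) = gauss_density z"
          using detA by (simp add: gauss_density_def K_def)
        moreover have "E z - \<theta> = A *v z" by (simp add: E_def)
        ultimately show "ennreal \<bar>det A\<bar> * (ennreal (exp (- ((E z - \<theta>) \<bullet> ((DG ** DG) *v (E z - \<theta>))) / 2) / (K * \<bar>det A\<bar>)) * indicator B (E z))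
            = ennreal (gauss_density z) * indicator (E -` B) z"
          using K by (simp add: quad indicator_def flip: ennreal_mult)
      qed
      also have "\<dots> = emeasure ?N (E -` B)"
        unfolding std_gauss_def by (subst emeasure_density) auto
      finally show ?thesis by (simp add: measure_def)
    qed
    show "\<bar>measure (gibbs_measure f) B - measure ?G B\<bar> \<le> \<tau> * (norm M)\<^sup>2 + 2 * exp (- (r - 3 * norm M)\<^sup>2 / 3)"
      unfolding gibbs gauss by (rule G.total_variation_bound[OF EB])
  qed
  then show ?thesis by (simp add: S\<tau> eff)
qed

end
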